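(* Let $\{F_t\}_{t\ge0}$ and $\{\bar F_t\}_{t\ge0}$ be two-dimensional (open-set irreducible) Lévy-type processes with symbols $q(x,\xi)$ and $\bar q(x,\xi)$, both radial in the co-variable $\xi$, and Lévy measures $\nu(x,dy)$ and $\bar\nu(x,dy)$, respectively. Assume that (i) $\nu(x,du\times\mathbb{R})$ is quasi-unimodal uniformly in $x\in\mathbb{R}^2$; (ii) there exists $u_0\ge0$ such that $\nu(x,B_u^c(0))\ge\bar\nu(x,B_u^c(0))$ for all $x\in\mathbb{R}^2$ and all $u\ge u_0$ (or, alternatively, $\nu(x,(u,\infty)\times\mathbb{R})\ge\bar\nu(x,(u,\infty)\times\mathbb{R})$ for all $x\in\mathbb{R}^2$ and all $u\ge u_0$). Then $$\int_{B_r(0)}\frac{d\xi}{\sup_{x\in\mathbb{R}^2}q(x,\xi)}=\infty\quad\text{for all } r>0$$ implies $$\int_{B_r(0)}\frac{d\xi}{\sup_{x\in\mathbb{R}^2}\bar q(x,\xi)}=\infty\quad\text{for all } r>0.$$ In addition, if $$\liminf_{|\xi|\to0}\inf_{x\in\mathbb{R}^2}\int_{\mathbb{R}^2}\frac{1-\cos\langle\xi,y\rangle}{|\xi|^2}\,\nu(x,dy)=\infty,$$ then $$\int_{B_r(0)}\frac{d\xi}{\inf_{x\in\mathbb{R}^2}\bar q(x,\xi)}<\infty\quad\text{for some } r>0$$ implies $$\int_{B_r(0)}\frac{d\xi}{\inf_{x\in\mathbb{R}^2}q(x,\xi)}<\infty\quad\text{for some } r>0.$$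
   Context: A Feller process on $\mathbb{R}^d$ is a Markov process $(\{F_t\}_{t\ge0},\{\mathbb{P}^x\}_{x\in\mathbb{R}^d})$ whose semigroup $P_tf(x)=\mathbb{E}^x[f(F_t)]$ is a strongly continuous semigroup on $C_\infty(\mathbb{R}^d)$, the continuous functions vanishing at infinity with the sup norm; its generator on $C_\infty(\mathbb{R}^d)$ is $(\mathcal{A},\mathcal{D}_{\mathcal{A}})$. If $C_c^\infty(\mathbb{R}^d)\subseteq\mathcal{D}_{\mathcal{A}}$, then on $C_c^\infty(\mathbb{R}^d)$ one has $\mathcal{A}f(x)=-\int_{\mathbb{R}^d}q(x,\xi)e^{i\langle\xi,x\rangle}\hat f(\xi)\,d\xi$, with $\hat f(\xi)=(2\pi)^{-d}\int e^{-i\langle\xi,x\rangle}f(x)\,dx$; $q:\mathbb{R}^d\times\mathbb{R}^d\to\mathbb{C}$ is called the symbol. It is measurable and locally bounded, and continuous and negative definite in the co-variable $\xi$. A Lévy-type process is a Feller process with (a) $C_c^\infty(\mathbb{R}^d)\subseteq\mathcal{D}_{\mathcal{A}}$, (b) $\sup_x|q(x,\xi)|\le K(1+|\xi|^2)$ for some finite $K>0$ and all $\xi$, (c) $q(x,0)=0$ for all $x$. Its symbol has the Lévy–Khintchine form $$q(x,\xi)=-i\langle\xi,b(x)\rangle+\tfrac12\langle\xi,C(x)\xi\rangle+\int_{\mathbb{R}^d}\left(1-e^{i\langle\xi,y\rangle}+i\langle\xi,y\rangle1_{B_1(0)}(y)\right)\nu(x,dy),$$ with $b(x)\in\mathbb{R}^d$,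 $C(x)$ symmetric non-negative definite, and $\nu(x,dy)$ a Borel kernel (the Lévy measure) with $\nu(x,\{0\})=0$, $\int\min\{1,|y|^2\}\nu(x,dy)<\infty$; $(b(x),C(x),\nu(x,dy))$ is the Lévy triplet. The process is $\varphi$-irreducible if there is a $\sigma$-finite measure $\varphi$ on $\mathbb{R}^d$ such that $\varphi(B)>0$ implies $\int_0^\infty\mathbb{P}^x(F_t\in B)\,dt>0$ for all $x$; it is open-set irreducible if it has such an irreducibility measure with full support. $B_r(x)$ is the open ball and $B_u^c(0)=\mathbb{R}^2\setminus B_u(0)$. The symbol is radial in the co-variable if $q(x,R\xi)=q(x,\xi)$ for all $x,\xi\in\mathbb{R}^2$ and all rotations $R$ of the plane; then $q$ is real and nonnegative, $b(x)=0$, $C(x)=c(x)I$ for a Borel function $c:\mathbb{R}^2\to[0,\infty)$, and $\nu(x,\cdot)$ is rotationally invariant. A symmetric Borel measure $\mu$ on $\mathbb{R}$ is quasi-unimodal (with respect to $v_0\ge0$) if $u\mapsto\mu((u,\infty))$ is a convex function on $(v_0,\infty)$. "Quasi-unimodal uniformly in $x$" means that one $v_0\ge 0$ works for all $x\in\mathbb{R}^2$. The measure $\nu(x,du\times\mathbb{R})$ is the projection of $\nu(x,\cdot)$ onto the first coordinate. Convention: $1/0=\infty$. *)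

theory Defs
  imports "HOL-Probability.Probability"
begin

section \<open>Function spaces\<close>

definition C_infty :: "('a::euclidean_space \<Rightarrow> real) set" where
  "C_infty = {f. continuous_on UNIV f \<and> (f \<longlongrightarrow> 0) at_infinity}"

primrec Ck :: "nat \<Rightarrow> ('a::euclidean_space \<Rightarrow> real) \<Rightarrow> bool" where
  "Ck 0 f \<longleftrightarrow> continuous_on UNIV f"
| "Ck (Suc k) f \<longleftrightarrow>
     f differentiable_on UNIV \<and> (\<forall>v\<in>Basis. Ck k (\<lambda>x. frechet_derivative f (at x) v))"

definition Cc_infty :: "('a::euclidean_space \<Rightarrow> real) set" where
  "Cc_infty = {f. (\<forall>k. Ck k f) \<and> compact (closure {x. f x \<noteq> 0})}"


section \<open>Feller processes\<close>

definition natural_filtration ::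
  "'w measure \<Rightarrow> (real \<Rightarrow> 'w \<Rightarrow> 'a::euclidean_space) \<Rightarrow> real \<Rightarrow> 'w measure" where
  "natural_filtration M F s =
     sigma (space M) {F u -` B \<inter> space M | u B. 0 \<le> u \<and> u \<le> s \<and> B \<in> sets borel}"

text \<open>Only the measurable space underlying \<open>M\<close> matters; the probabilities are the \<open>P x\<close>.\<close>

locale markov_process =
  fixes M :: "'w measure"
    and F :: "real \<Rightarrow> 'w \<Rightarrow> 'a::euclidean_space"
    and P :: "'a \<Rightarrow> 'w measure"
  assumes prob_space_P: "\<And>x. prob_space (P x)"
    and sets_P: "\<And>x. sets (P x) = sets M"
    and measurable_F: "\<And>t. 0 \<le> t \<Longrightarrow> F t \<in> borel_measurable M"
    and measurable_start: "\<And>t B. 0 \<le> t \<Longrightarrow> B \<in> sets borel \<Longrightarrow>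
          (\<lambda>x. measure (P x) (F t -` B \<inter> space M)) \<in> borel_measurable borel"
    and start: "\<And>x. AE \<omega> in P x. F 0 \<omega> = x"
    and markov: "\<And>x s t B. 0 \<le> s \<Longrightarrow> 0 \<le> t \<Longrightarrow> B \<in> sets borel \<Longrightarrow>
          AE \<omega> in P x.
            real_cond_exp (P x) (natural_filtration M F s)
              (indicator (F (s + t) -` B \<inter> space M)) \<omega>
            = measure (P (F s \<omega>)) (F t -` B \<inter> space M)"

definition transition_semigroup ::
  "(real \<Rightarrow> 'w \<Rightarrow> 'a::euclidean_space) \<Rightarrow> ('a \<Rightarrow> 'w measure) \<Rightarrow> real \<Rightarrow> ('a \<Rightarrow> real) \<Rightarrow> 'a \<Rightarrow> real"
  where "transition_semigroup F P t f x = (\<integral>\<omega>. f (F t \<omega>) \<partial>P x)"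

text \<open>Linearity and contractivity are not listed: they are automatic for operators given by
  expectations. Uniform convergence on \<open>UNIV\<close> is convergence in the sup norm.\<close>

definition strongly_continuous_semigroup ::
  "(real \<Rightarrow> ('a::euclidean_space \<Rightarrow> real) \<Rightarrow> 'a \<Rightarrow> real) \<Rightarrow> bool" where
  "strongly_continuous_semigroup T \<longleftrightarrow>
     (\<forall>f\<in>C_infty. (\<forall>t\<ge>0. T t f \<in> C_infty) \<and> T 0 f = f \<and>
        (\<forall>s\<ge>0. \<forall>t\<ge>0. T (s + t) f = T s (T t f)) \<and>
        uniform_limit UNIV (\<lambda>t. T t f) f (at_right 0))"

locale feller_process = markov_process +
  assumes feller: "strongly_continuous_semigroup (transition_semigroup F P)"

text \<open>The graph of the generator \<open>(A, D\<^sub>A)\<close>, so that \<open>D\<^sub>A\<close> is its \<^const>\<open>Domain\<close>.\<close>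

definition generator ::
  "(real \<Rightarrow> 'w \<Rightarrow> 'a::euclidean_space) \<Rightarrow> ('a \<Rightarrow> 'w measure) \<Rightarrow> (('a \<Rightarrow> real) \<times> ('a \<Rightarrow> real)) set"
  where
  "generator F P = {(f, g). f \<in> C_infty \<and> g \<in> C_infty \<and>
     uniform_limit UNIV (\<lambda>t x. (transition_semigroup F P t f x - f x) / t) g (at_right 0)}"


section \<open>Symbols and Levy-type processes\<close>

definition fourier :: "(real^'n \<Rightarrow> real) \<Rightarrow> real^'n \<Rightarrow> complex" where
  "fourier f \<xi> =
     (\<integral>x. iexp (- (\<xi> \<bullet> x)) * complex_of_real (f x) \<partial>lborel) / (2 * pi) ^ CARD('n)"

text \<open>Negative definiteness in the sense of Schoenberg.\<close>

definition negative_definite :: "('a::euclidean_space \<Rightarrow> complex) \<Rightarrow> bool" where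
  "negative_definite \<psi> \<longleftrightarrow>
     (\<forall>(n::nat) (\<xi> :: nat \<Rightarrow> 'a) (c :: nat \<Rightarrow> complex).
        let S = (\<Sum>j<n. \<Sum>k<n. (\<psi> (\<xi> j) + cnj (\<psi> (\<xi> k)) - \<psi> (\<xi> j - \<xi> k)) * c j * cnj (c k))
        in Im S = 0 \<and> 0 \<le> Re S)"

definition is_symbol ::
  "(real \<Rightarrow> 'w \<Rightarrow> real^'n) \<Rightarrow> (real^'n \<Rightarrow> 'w measure) \<Rightarrow> (real^'n \<Rightarrow> real^'n \<Rightarrow> complex) \<Rightarrow> bool"
  where
  "is_symbol F P q \<longleftrightarrow>
     (\<lambda>(x, \<xi>). q x \<xi>) \<in> borel_measurable borel \<and>
     (\<forall>S. compact S \<longrightarrow> bounded ((\<lambda>(x, \<xi>). q x \<xi>) ` S)) \<and>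
     (\<forall>x. continuous_on UNIV (q x) \<and> negative_definite (q x)) \<and>
     (\<forall>f g x. f \<in> Cc_infty \<longrightarrow> (f, g) \<in> generator F P \<longrightarrow>
        complex_of_real (g x) = - (\<integral>\<xi>. q x \<xi> * iexp (\<xi> \<bullet> x) * fourier f \<xi> \<partial>lborel))"

locale levy_type_process = feller_process M F P
  for M :: "'w measure" and F :: "real \<Rightarrow> 'w \<Rightarrow> real^'n" and P :: "real^'n \<Rightarrow> 'w measure" +
  fixes q :: "real^'n \<Rightarrow> real^'n \<Rightarrow> complex"
  assumes Cc_infty_domain: "Cc_infty \<subseteq> Domain (generator F P)"
    and symbol: "is_symbol F P q"
    and bounded_coefficients: "\<exists>K>0. \<forall>x \<xi>. cmod (q x \<xi>) \<le> K * (1 + (norm \<xi>)\<^sup>2)"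
    and symbol_zero: "\<And>x. q x 0 = 0"

definition levy_triplet ::
  "(real^'n \<Rightarrow> real^'n \<Rightarrow> complex) \<Rightarrow> (real^'n \<Rightarrow> real^'n) \<Rightarrow> (real^'n \<Rightarrow> real^'n^'n)
     \<Rightarrow> (real^'n \<Rightarrow> (real^'n) measure) \<Rightarrow> bool" where
  "levy_triplet q b C \<nu> \<longleftrightarrow>
     (\<forall>x. transpose (C x) = C x \<and> (\<forall>\<xi>. 0 \<le> \<xi> \<bullet> (C x *v \<xi>))) \<and>
     (\<forall>x. sets (\<nu> x) = sets borel) \<and>
     (\<forall>B\<in>sets borel. (\<lambda>x. emeasure (\<nu> x) B) \<in> borel_measurable borel) \<and>
     (\<forall>x. emeasure (\<nu> x) {0} = 0 \<and> (\<integral>\<^sup>+ y. ennreal (min 1 ((norm y)\<^sup>2)) \<partial>\<nu> x) < \<infinity>) \<and>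
     (\<forall>x \<xi>. q x \<xi> = - \<i> * complex_of_real (\<xi> \<bullet> b x)
         + complex_of_real ((1/2) * (\<xi> \<bullet> (C x *v \<xi>)))
         + (\<integral>y. (1 - iexp (\<xi> \<bullet> y) + \<i> * complex_of_real (\<xi> \<bullet> y) * indicator (ball 0 1) y) \<partial>\<nu> x))"

definition levy_measure ::
  "(real^'n \<Rightarrow> real^'n \<Rightarrow> complex) \<Rightarrow> (real^'n \<Rightarrow> (real^'n) measure) \<Rightarrow> bool" where
  "levy_measure q \<nu> \<longleftrightarrow> (\<exists>b C. levy_triplet q b C \<nu>)"


section \<open>Irreducibility\<close>

definition irreducibility_measure ::
  "'w measure \<Rightarrow> (real \<Rightarrow> 'w \<Rightarrow> 'a::euclidean_space) \<Rightarrow> ('a \<Rightarrow> 'w measure) \<Rightarrow> 'a measure \<Rightarrow> bool"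
  where
  "irreducibility_measure M F P \<phi> \<longleftrightarrow>
     sigma_finite_measure \<phi> \<and> sets \<phi> = sets borel \<and>
     (\<forall>B\<in>sets borel. emeasure \<phi> B > 0 \<longrightarrow>
        (\<forall>x. (\<integral>\<^sup>+ t\<in>{0..}. emeasure (P x) (F t -` B \<inter> space M) \<partial>lborel) > 0))"

definition open_set_irreducible ::
  "'w measure \<Rightarrow> (real \<Rightarrow> 'w \<Rightarrow> 'a::euclidean_space) \<Rightarrow> ('a \<Rightarrow> 'w measure) \<Rightarrow> bool" where
  "open_set_irreducible M F P \<longleftrightarrow>
     (\<exists>\<phi>. irreducibility_measure M F P \<phi> \<and> (\<forall>U. open U \<longrightarrow> U \<noteq> {} \<longrightarrow> emeasure \<phi> U > 0))"


section \<open>Radial symbols and quasi-unimodal measures\<close>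

definition radial_in_covariable :: "(real^2 \<Rightarrow> real^2 \<Rightarrow> complex) \<Rightarrow> bool" where
  "radial_in_covariable q \<longleftrightarrow> (\<forall>x \<xi> R. rotation_matrix R \<longrightarrow> q x (R *v \<xi>) = q x \<xi>)"

text \<open>The tails are required to be finite because \<^const>\<open>measure\<close> is 0 on sets of infinite measure.\<close>

definition quasi_unimodal :: "real \<Rightarrow> real measure \<Rightarrow> bool" where
  "quasi_unimodal v\<^sub>0 \<mu> \<longleftrightarrow>
     sets \<mu> = sets borel \<and> distr \<mu> borel uminus = \<mu> \<and>
     (\<forall>u>v\<^sub>0. emeasure \<mu> {u<..} < \<infinity>) \<and>
     convex_on {v\<^sub>0<..} (\<lambda>u. measure \<mu> {u<..})"

text \<open>The measure \<open>\<nu>(du \<times> \<real>)\<close>.\<close>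

definition proj1 :: "(real^2) measure \<Rightarrow> real measure" where
  "proj1 \<mu> = distr \<mu> borel (\<lambda>y. y $ 1)"

text \<open>A symbol that is radial in the co-variable is real and nonnegative, so nothing is lost by
  passing to the real part and to \<^typ>\<open>ennreal\<close>, where \<open>1 / 0 = \<infinity>\<close> and \<open>1 / \<infinity> = 0\<close>.\<close>

definition sup_symbol :: "('a \<Rightarrow> 'b \<Rightarrow> complex) \<Rightarrow> 'b \<Rightarrow> ennreal" where
  "sup_symbol q \<xi> = (SUP x. ennreal (Re (q x \<xi>)))"

definition inf_symbol :: "('a \<Rightarrow> 'b \<Rightarrow> complex) \<Rightarrow> 'b \<Rightarrow> ennreal" where
  "inf_symbol q \<xi> = (INF x. ennreal (Re (q x \<xi>)))"

end

theory Submission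
  imports Defs
begin

text \<open>
  For a plane exponent \<open>\<psi>\<close> that is radial, \<open>Re (\<psi> \<xi>)\<close> is comparable, with absolute constants, to a
  quadratic Gaussian term plus the truncated second moment of the Levy measure, the integral of
  \<open>min 1 ((norm \<xi> * norm y)\<^sup>2)\<close>. The upper bound is the inequality \<open>1 - cos s \<le> 2 * min 1 (s\<^sup>2)\<close>. For the
  lower bound the zeros of \<open>1 - cos\<close> must be averaged out, and here the plane helps: a vector of length at
  most \<open>2 * norm \<xi>\<close> is a sum of two vectors of length \<open>norm \<xi>\<close>, so that \<open>Re (\<psi> \<eta>) \<le> 4 * Re (\<psi> \<xi>)\<close> for
  all shorter \<open>\<eta>\<close> (\<open>Re_exponent_le_of_norm_le\<close>), and \<open>Re (\<psi> \<xi>)\<close> controls an average of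
  \<open>1 - cos\<close> over dilations (\<open>truncated_square_le\<close>).

  Truncated second moments depend monotonically on the tails (\<open>nn_integral_truncated_square_mono\<close>). Domination
  of the tails beyond \<open>u\<^sub>0\<close> therefore gives, with one constant \<open>A\<close> for all states,
  \<open>Re (q' x \<xi>) \<le> A * (Re (q x \<xi>) + (norm \<xi>)\<^sup>2)\<close> (\<open>symbol_comparison\<close>); the quadratic term accounts for
  the Gaussian part and the small jumps of the second process, which are bounded uniformly in \<open>x\<close> by the growth bound
  on its symbol. When tails are compared over half-planes only, the left half-plane has to be controlled by the
  right one. This follows from the evenness of the exponent and the uniqueness theorem for characteristic
  functions, applied to second differences of \<open>\<psi>\<close> (\<open>half_line_symmetry\<close>).

  It remains to absorb the quadratic term. In the first implication, either some exponent of the first process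
  is not zero, and then the supremum of its symbol has at least quadratic size near the origin
  (\<open>Re_exponent_quadratic_lower\<close>), or the symbol vanishes near the origin and \<open>1 / sup_symbol q' \<xi>\<close> is at least a
  multiple of \<open>1 / (norm \<xi>)\<^sup>2\<close>, which is not integrable at the origin of the plane
  (\<open>nn_integral_inverse_square_ball\<close>). In the second implication the assumption on the lower limit says that
  the jump part of the symbol dominates \<open>(norm \<xi>)\<^sup>2\<close> uniformly in \<open>x\<close>.
\<close>

section \<open>Trigonometric inequalities\<close>

text \<open>The two sides differ by \<open>1 - cos (a - b)\<close> plus \<open>2 * (1 - cos a) * (1 - cos b)\<close>, both nonnegative.
  This is what makes exponents grow at most quadratically.\<close>

lemma two_one_minus_cos_le: "1 - cos (a + b) \<le> 2 * (1 - cos a) + 2 * (1 - cos (b::real))"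
proof -
  have "1 - cos (a + b) \<le> (1 - cos (a + b)) + (1 - cos (a - b))" by simp
  also have "\<dots> = 2 - 2 * cos a * cos b" by (simp add: cos_add cos_diff)
  also have "\<dots> = 2 * (1 - cos a) + 2 * (1 - cos b) - 2 * (1 - cos a) * (1 - cos b)"
    by (simp add: algebra_simps)
  also have "\<dots> \<le> 2 * (1 - cos a) + 2 * (1 - cos b)"
    by simp
  finally show ?thesis .
qed

lemma one_minus_cos_le: "1 - cos (s::real) \<le> 2 * min 1 (s\<^sup>2)"
proof -
  have "1 - cos s = 2 * (sin (s / 2))\<^sup>2"
    using cos_double_sin[of "s/2"] by simp
  moreover have "(sin (s / 2))\<^sup>2 \<le> (s / 2)\<^sup>2"
    using abs_sin_x_le_abs_x[of "s/2"] by (simp only: abs_le_square_iff)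
  moreover have "(sin (s / 2))\<^sup>2 \<le> 1" using abs_sin_le_one[of "s/2"] by (simp only: abs_square_le_1)
  moreover have "(s / 2)\<^sup>2 \<le> s\<^sup>2" by (simp add: power_divide)
  ultimately show ?thesis by linarith
qed

text \<open>Pointwise, \<open>1 - cos s\<close> vanishes at every multiple of \<open>2 * pi\<close> and so has no lower bound by
  \<open>min 1 (s\<^sup>2)\<close>. Averaging over the dilations \<open>t * s\<close> removes these zeros: the average is
  \<open>1 - sin s / s\<close>, which is at least \<open>1/2\<close> for \<open>\<bar>s\<bar> \<ge> 2\<close> and is estimated by
  the Taylor polynomial of the sine for smaller \<open>\<bar>s\<bar>\<close>.\<close>

lemma nn_integral_one_minus_cos_ge:
  "(\<integral>\<^sup>+ t\<in>{0..1}. ennreal (1 - cos (t * s)) \<partial>lborel) \<ge> ennreal (min 1 (s\<^sup>2) / 8)"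
proof (cases "s = 0")
  case False
  have "(\<integral>\<^sup>+ t. ennreal (1 - cos (t * s)) * indicator {0..1} t \<partial>lborel)
      = ennreal ((1 - sin (1 * s) / s) - (0 - sin (0 * s) / s))"
    by (rule nn_integral_FTC_Icc) (use False in \<open>auto intro!: derivative_eq_intros\<close>)
  moreover have "min 1 (s\<^sup>2) / 8 \<le> 1 - sin s / s"
  proof -
    have pos: "min 1 (s\<^sup>2) / 8 \<le> 1 - sin s / s" if "s > 0" for s :: real
    proof (cases "s \<ge> 2")
      case True
      \<comment> \<open>Here \<open>1 - sin s / s\<close> is at least \<open>1/2\<close>; the case below uses the Taylor polynomial of degree 3.\<close>
      have "sin s / s \<le> 1 / s" using True by (intro divide_right_mono) auto
      also have "\<dots> \<le> 1 / 2" using True by (intro divide_left_mono) auto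
      finally have "sin s / s \<le> 1 / 2" .
      then have "1 / 8 \<le> 1 - sin s / s" by linarith
      then show ?thesis by (auto simp: min_def)
    next
      case False
      have "\<bar>sin s - (\<Sum>i<5. sin_coeff i * s ^ i)\<bar> \<le> inverse (fact 5) * \<bar>s\<bar> ^ 5"
        by (rule Maclaurin_sin_bound)
      moreover have "(\<Sum>i<5. sin_coeff i * s ^ i) = s - s^3/6"
        by (simp add: lessThan_nat_numeral sin_coeff_def fact_numeral)
      moreover have "inverse (fact 5) * \<bar>s\<bar> ^ 5 = s^5/120"
        using that by (simp add: fact_numeral)
      ultimately have "sin s \<le> s - s^3/6 + s^5/120" by linarith
      then have "sin s / s \<le> (s - s^3/6 + s^5/120) / s" using that by (simp add: divide_right_mono)
      also have "\<dots> = 1 - s\<^sup>2/6 + s^4/120"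
        using that by (simp add: field_simps eval_nat_numeral)
      finally have "sin s / s \<le> 1 - s\<^sup>2/6 + s\<^sup>2 * s\<^sup>2/120" by (simp add: eval_nat_numeral)
      moreover have "s\<^sup>2 \<le> 4" using False that power_mono[of s 2 2] by simp
      then have "s\<^sup>2 * s\<^sup>2 \<le> s\<^sup>2 * 4" by (intro mult_left_mono) auto
      ultimately have "sin s / s \<le> 1 - s\<^sup>2 / 8" using zero_le_power2[of s] by linarith
      then have "s\<^sup>2 / 8 \<le> 1 - sin s / s" by simp
      moreover have "min 1 (s\<^sup>2) / 8 \<le> s\<^sup>2 / 8" by (intro divide_right_mono) auto
      ultimately show ?thesis by (rule order_trans[rotated])
    qed
    show ?thesis using pos[of s] pos[of "-s"] False by (cases "s > 0") auto
  qed
  ultimately show ?thesis by (simp add: ennreal_leI)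
qed simp

section \<open>Extended nonnegative integrals\<close>

lemma ennreal_reciprocal_le_scale:
  assumes "0 < B" "a \<le> ennreal B * b"
  shows "1 / b \<le> ennreal B * (1 / a)"
proof (cases "a = 0 \<or> b = \<infinity>")
  case True
  then show ?thesis using assms(1) by (auto simp: ennreal_mult_top divide_ennreal_def)
next
  case False
  then obtain y where b: "b = ennreal y" "0 \<le> y" by (cases b) auto
  then have "a \<le> ennreal (B * y)" using assms by (simp add: ennreal_mult)
  moreover from this obtain x where a: "a = ennreal x" "0 < x"
    using False by (cases a) (auto simp: top_unique less_le)
  ultimately have xy: "x \<le> B * y" using assms(1) b(2) by (simp add: ennreal_le_iff)
  then have y: "0 < y" using a(2) assms(1) b(2) by (cases "y = 0") auto
  have "1 / y \<le> B * (1 / x)" using xy y a(2) by (simp add: field_simps)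
  then have "ennreal (1 / y) \<le> ennreal (B * (1 / x))" by (rule ennreal_leI)
  then show ?thesis
    using y a b assms(1) by (simp only: ennreal_mult less_imp_le zero_le_divide_1_iff divide_ennreal
        ennreal_1[symmetric] zero_le_one)
qed

text \<open>The integrand is arbitrary because it will be built from suprema and infima over uncountably many
  states. Dividing a simple minorant of \<open>c * f\<close> by \<open>c\<close> gives a simple
  minorant of \<open>f\<close>.\<close>

lemma nn_integral_cmult_le:
  assumes c: "0 < c"
  shows "(\<integral>\<^sup>+ x. ennreal c * f x \<partial>M) \<le> ennreal c * (\<integral>\<^sup>+ x. f x \<partial>M)"
  unfolding nn_integral_def[of M "\<lambda>x. ennreal c * f x"]
proof (rule SUP_least, clarify)
  fix s assume s: "simple_function M s" and le: "s \<le> (\<lambda>x. ennreal c * f x)"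
  have inv: "ennreal (1 / c) * ennreal c = 1" using c by (simp flip: ennreal_mult)
  have "(\<integral>\<^sup>+ x. ennreal (1 / c) * s x \<partial>M) \<le> (\<integral>\<^sup>+ x. f x \<partial>M)"
  proof (rule nn_integral_mono)
    fix x
    have "ennreal (1 / c) * s x \<le> ennreal (1 / c) * (ennreal c * f x)"
      using le by (auto simp: le_fun_def intro: mult_left_mono)
    also have "\<dots> = f x" using inv by (simp flip: mult.assoc)
    finally show "ennreal (1 / c) * s x \<le> f x" .
  qed
  then have "ennreal (1 / c) * integral\<^sup>N M s \<le> integral\<^sup>N M f"
    using s by (simp add: nn_integral_cmult borel_measurable_simple_function)
  then have "ennreal c * (ennreal (1 / c) * integral\<^sup>N M s) \<le> ennreal c * integral\<^sup>N M f"
    by (rule mult_left_mono) simp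
  moreover have "ennreal c * (ennreal (1 / c) * integral\<^sup>N M s) = integral\<^sup>N M s"
    using inv by (metis mult.assoc mult.commute mult_1)
  ultimately show "integral\<^sup>S M s \<le> ennreal c * integral\<^sup>N M f"
    using s by (simp add: nn_integral_eq_simple_integral)
qed

text \<open>The function \<open>1 / (norm \<xi>)\<^sup>2\<close> has in the plane the homogeneity of a scale-invariant measure: the integrals
  over the balls of radius \<open>r\<close> and \<open>r / 2\<close> agree, although they differ by the integral over a shell,
  which is positive. Only an infinite integral allows this.\<close>

lemma nn_integral_inverse_square_ball:
  assumes "0 < r" 
  shows "(\<integral>\<^sup>+ \<xi>\<in>ball 0 r. 1 / ennreal ((norm \<xi>)\<^sup>2) \<partial>(lborel :: (real^2) measure)) = \<infinity>"
proof -
  define g :: "real^2 \<Rightarrow> ennreal" where "g \<xi> = 1 / ennreal ((norm \<xi>)\<^sup>2)" for \<xi>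
  define I where "I r = (\<integral>\<^sup>+ \<xi>. g \<xi> * indicator (ball 0 r) \<xi> \<partial>lborel)" for r
  have [measurable]: "g \<in> borel_measurable borel" unfolding g_def by measurable
  have meas: "(\<lambda>\<xi>. g \<xi> * indicator (ball 0 s) \<xi>) \<in> borel_measurable borel" for s
    by (intro borel_measurable_times_ennreal borel_measurable_indicator) auto
  have half: "I (r / 2) = I r"
  proof -
    have g2: "g ((1/2) *\<^sub>R \<xi>) = 4 * g \<xi>" for \<xi>
    proof (cases "\<xi> = 0")
      case False
      have "4 * g \<xi> = ennreal 4 * ennreal (1 / (norm \<xi>)\<^sup>2)"
        using False by (simp add: g_def divide_ennreal flip: ennreal_1)
      also have "\<dots> = ennreal (4 * (1 / (norm \<xi>)\<^sup>2))" by (rule ennreal_mult[symmetric]) auto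
      also have "\<dots> = g ((1/2) *\<^sub>R \<xi>)"
        using False by (simp add: g_def divide_ennreal power_divide flip: ennreal_1)
      finally show ?thesis ..
    qed (simp add: g_def ennreal_mult_top)
    have ball2: "indicator (ball 0 (r/2)) ((1/2) *\<^sub>R \<xi>) = (indicator (ball 0 r) \<xi> :: ennreal)" for \<xi> :: "real^2"
      by (auto simp: indicator_def)
    have "I (r / 2) = (\<integral>\<^sup>+ \<xi>. g \<xi> * indicator (ball 0 (r/2)) \<xi>
        \<partial>density (distr lborel borel (\<lambda>x. 0 + (1/2) *\<^sub>R x)) (\<lambda>_. ennreal (\<bar>1/2\<bar> ^ DIM(real^2))))"
      unfolding I_def by (subst lborel_affine[of "1/2" 0]) auto
    also have "\<dots> = (\<integral>\<^sup>+ \<xi>. ennreal (\<bar>1/2\<bar> ^ DIM(real^2)) *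
        (g (0 + (1/2) *\<^sub>R \<xi>) * indicator (ball 0 (r/2)) (0 + (1/2) *\<^sub>R \<xi>)) \<partial>lborel)"
    proof -
      have push: "(\<integral>\<^sup>+ x. h x \<partial>density (distr lborel borel S) (\<lambda>_. c)) = (\<integral>\<^sup>+ x. c * h (S x) \<partial>lborel)"
        if [measurable]: "h \<in> borel_measurable borel" "S \<in> borel_measurable borel"
        for h :: "real^2 \<Rightarrow> ennreal" and S :: "real^2 \<Rightarrow> real^2" and c
        by (simp add: nn_integral_density nn_integral_distr)
      show ?thesis by (rule push[OF meas]) simp
    qed
    also have "\<dots> = (\<integral>\<^sup>+ \<xi>. ennreal (1/4) * (4 * g \<xi> * indicator (ball 0 r) \<xi>) \<partial>lborel)"
      by (simp add: ball2 g2 power2_eq_square)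
    also have "\<dots> = ennreal (1/4) * (ennreal 4 * I r)"
      unfolding I_def mult.assoc using meas[of r]
      by (subst nn_integral_cmult, intro borel_measurable_times_ennreal[OF borel_measurable_const], simp,
          subst nn_integral_cmult, simp_all)
    also have "ennreal (1/4) * (ennreal 4 * I r) = (ennreal (1/4) * ennreal 4) * I r"
      by (simp only: mult.assoc)
    also have "ennreal (1/4) * ennreal 4 = 1" by (subst ennreal_mult[symmetric]) simp_all
    also have "1 * I r = I r" by simp
    finally show ?thesis .
  qed
  have split: "I r = I (r/2) + (\<integral>\<^sup>+ \<xi>. g \<xi> * indicator (ball 0 r - ball 0 (r/2)) \<xi> \<partial>lborel)"
    unfolding I_def using assms
    by (subst nn_integral_add[symmetric]) (auto intro!: nn_integral_cong simp: indicator_def)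
  have shell: "(\<integral>\<^sup>+ \<xi>. g \<xi> * indicator (ball 0 r - ball 0 (r/2)) \<xi> \<partial>lborel) > 0"
  proof -
    have "0 < ennreal (pi * r\<^sup>2) - ennreal (pi * (r/2)\<^sup>2)"
      using assms by (subst ennreal_minus) (auto simp: power_divide)
    also have "\<dots> = emeasure lborel (ball (0::real^2) r - ball 0 (r/2))"
      using assms by (subst emeasure_Diff) (auto simp: emeasure_ball unit_ball_vol_2)
    finally have "0 < ennreal (1 / r\<^sup>2) * emeasure lborel (ball (0::real^2) r - ball 0 (r/2))"
      using assms by (simp add: ennreal_zero_less_mult_iff)
    also have "\<dots> = (\<integral>\<^sup>+ \<xi>. ennreal (1 / r\<^sup>2) * indicator (ball (0::real^2) r - ball 0 (r/2)) \<xi> \<partial>lborel)"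
      by (simp add: nn_integral_cmult_indicator)
    also have "\<dots> \<le> (\<integral>\<^sup>+ \<xi>. g \<xi> * indicator (ball 0 r - ball 0 (r/2)) \<xi> \<partial>lborel)"
    proof (rule nn_integral_mono)
      fix \<xi> :: "real^2"
      show "ennreal (1 / r\<^sup>2) * indicator (ball (0::real^2) r - ball 0 (r/2)) \<xi>
          \<le> g \<xi> * indicator (ball 0 r - ball 0 (r/2)) \<xi>"
      proof (cases "\<xi> \<in> ball 0 r - ball 0 (r/2)")
        case True
        then have "0 < norm \<xi>" "norm \<xi> \<le> r" using assms by auto
        then have "1 / r\<^sup>2 \<le> 1 / (norm \<xi>)\<^sup>2" 
          using assms by (auto intro!: divide_left_mono power_mono)
        then have "ennreal (1 / r\<^sup>2) \<le> g \<xi>"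
          using \<open>0 < norm \<xi>\<close> by (simp add: g_def divide_ennreal ennreal_leI flip: ennreal_1)
        then show ?thesis using True by simp
      qed simp
    qed
    finally show ?thesis .
  qed
  have "I r = \<infinity>"
    using shell split half ennreal_add_left_cancel[of "I r" 0] by (auto simp: less_le)
  then show ?thesis by (simp add: I_def g_def)
qed

text \<open>A layer-cake argument: \<open>min 1 ((\<rho> * s)\<^sup>2)\<close> is the Lebesgue measure of the \<open>t \<in> {0..<1}\<close> with
  \<open>sqrt t / \<rho> < s\<close>, so both integrals are superpositions of tails of \<open>f\<close>, and the cut-off at
  \<open>a\<close> ensures that only tails beyond \<open>a\<close> occur.\<close>

lemma nn_integral_truncated_square_mono:
  fixes \<alpha> \<beta> :: "'a measure"
  assumes "sigma_finite_measure \<alpha>" "sigma_finite_measure \<beta>" and sets: "sets \<alpha> = sets \<beta>"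
    and [measurable]: "f \<in> borel_measurable \<beta>"
    and tails: "\<And>u. a \<le> u \<Longrightarrow> emeasure \<beta> {y\<in>space \<beta>. u < f y} \<le> emeasure \<alpha> {y\<in>space \<alpha>. u < f y}"
    and a: "0 \<le> a" and \<rho>: "0 < \<rho>"
  shows "(\<integral>\<^sup>+ y\<in>{y. a < f y}. ennreal (min 1 ((\<rho> * f y)\<^sup>2)) \<partial>\<beta>)
       \<le> (\<integral>\<^sup>+ y\<in>{y. a < f y}. ennreal (min 1 ((\<rho> * f y)\<^sup>2)) \<partial>\<alpha>)"
proof -
  \<comment> \<open>The threshold of layer \<open>t\<close>.\<close>
  define T where "T t = max a (sqrt t / \<rho>)" for t
  have [measurable]: "T \<in> borel_measurable borel" unfolding T_def by measurable
  have layer: "ennreal (min 1 ((\<rho> * s)\<^sup>2)) * indicator {s. a < s} s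
      = (\<integral>\<^sup>+ t. indicator {0..<1} t * indicator {z. T t < z} s \<partial>lborel)" for s
  proof (cases "a < s")
    case True
    have "T t < s \<longleftrightarrow> t < (\<rho> * s)\<^sup>2" if "0 \<le> t" for t
    proof -
      have "T t < s \<longleftrightarrow> sqrt t < \<rho> * s" using True \<rho> by (simp add: T_def field_simps)
      also have "\<dots> \<longleftrightarrow> t < (\<rho> * s)\<^sup>2"
        using True \<rho> a that by (metis less_eq_real_def mult_nonneg_nonneg order_le_less_trans
            real_sqrt_less_iff real_sqrt_unique)
      finally show ?thesis .
    qed
    then have "(\<integral>\<^sup>+ t. indicator {0..<1} t * indicator {z. T t < z} s \<partial>lborel)
      = (\<integral>\<^sup>+ t. indicator {0..<min 1 ((\<rho> * s)\<^sup>2)} t \<partial>lborel)"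
      by (intro nn_integral_cong) (auto simp: indicator_def)
    then show ?thesis using True by simp
  next
    case False
    then have "(\<integral>\<^sup>+ t. indicator {0..<1} t * indicator {z. T t < z} s \<partial>lborel) = integral\<^sup>N lborel (\<lambda>t::real. 0)"
      by (intro nn_integral_cong) (auto simp: T_def indicator_def)
    with False show ?thesis by simp
  qed
  have swap: "(\<integral>\<^sup>+ y\<in>{y. a < f y}. ennreal (min 1 ((\<rho> * f y)\<^sup>2)) \<partial>\<mu>)
      = (\<integral>\<^sup>+ t. indicator {0..<1} t * emeasure \<mu> {y\<in>space \<mu>. T t < f y} \<partial>lborel)"
    if "sigma_finite_measure \<mu>" and [measurable]: "f \<in> borel_measurable \<mu>" for \<mu>
  proof -
    interpret pair_sigma_finite \<mu> lborel
      using that(1) by (simp add: pair_sigma_finite_def sigma_finite_lborel)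
    have "(\<integral>\<^sup>+ y\<in>{y. a < f y}. ennreal (min 1 ((\<rho> * f y)\<^sup>2)) \<partial>\<mu>)
        = (\<integral>\<^sup>+ y. \<integral>\<^sup>+ t. indicator {0..<1} t * indicator {z. T t < z} (f y) \<partial>lborel \<partial>\<mu>)"
      using layer[of "f _"] by (intro nn_integral_cong) (simp add: indicator_def)
    also have "\<dots> = (\<integral>\<^sup>+ t. \<integral>\<^sup>+ y. indicator {0..<1} t * indicator {z. T t < z} (f y) \<partial>\<mu> \<partial>lborel)"
      by (rule Fubini'[symmetric]) (simp add: indicator_def, measurable)
    also have "\<dots> = (\<integral>\<^sup>+ t. indicator {0..<1} t * emeasure \<mu> {y\<in>space \<mu>. T t < f y} \<partial>lborel)"
    proof (rule nn_integral_cong)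
      fix t
      have "(\<integral>\<^sup>+ y. indicator {0..<1} t * indicator {z. T t < z} (f y) \<partial>\<mu>)
          = (\<integral>\<^sup>+ y. indicator {0..<1} t * indicator {y\<in>space \<mu>. T t < f y} y \<partial>\<mu>)"
        by (intro nn_integral_cong) (auto simp: indicator_def)
      also have "\<dots> = indicator {0..<1} t * emeasure \<mu> {y\<in>space \<mu>. T t < f y}"
        by (rule nn_integral_cmult_indicator) measurable
      finally show "(\<integral>\<^sup>+ y. indicator {0..<1} t * indicator {z. T t < z} (f y) \<partial>\<mu>)
          = indicator {0..<1} t * emeasure \<mu> {y\<in>space \<mu>. T t < f y}" .
    qed
    finally show ?thesis .
  qed
  have [measurable]: "f \<in> borel_measurable \<alpha>"
    using assms(4) sets by (simp cong: measurable_cong_sets)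
  show ?thesis
    unfolding swap[OF assms(1) \<open>f \<in> borel_measurable \<alpha>\<close>] swap[OF assms(2,4)]
    by (intro nn_integral_mono mult_left_mono tails) (auto simp: T_def)
qed

section \<open>Levy-Khintchine exponents\<close>

lemma iexp_add_iexp_diff: "iexp (a + c) + iexp (a - c) = iexp a * complex_of_real (2 * cos c)"
  for a c :: real
  unfolding cis_conv_exp[symmetric]
  by (simp add: complex_eq_iff cos_add sin_add cos_diff sin_diff)

text \<open>The exponent at a frozen state \<open>x\<close>: a symbol with a Levy triplet provides one such \<open>\<psi>\<close> for each state,
  and all estimates have constants that do not depend on the triplet.\<close>

locale levy_exponent =
  fixes \<psi> :: "real^'n \<Rightarrow> complex" and b :: "real^'n" and C :: "real^'n^'n"
    and \<nu> :: "(real^'n) measure"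
  assumes C_nonneg: "\<And>\<xi>. 0 \<le> \<xi> \<bullet> (C *v \<xi>)"
    and sets_\<nu> [measurable_cong]: "sets \<nu> = sets borel"
    and \<nu>_zero: "emeasure \<nu> {0} = 0"
    and \<nu>_moment: "(\<integral>\<^sup>+ y. ennreal (min 1 ((norm y)\<^sup>2)) \<partial>\<nu>) < \<infinity>"
    and exponent: "\<And>\<xi>. \<psi> \<xi> = - \<i> * complex_of_real (\<xi> \<bullet> b)
         + complex_of_real ((1/2) * (\<xi> \<bullet> (C *v \<xi>)))
         + (\<integral>y. (1 - iexp (\<xi> \<bullet> y) + \<i> * complex_of_real (\<xi> \<bullet> y) * indicator (ball 0 1) y) \<partial>\<nu>)"
begin

lemma space_\<nu> [simp]: "space \<nu> = UNIV"
  using sets_eq_imp_space_eq[OF sets_\<nu>] by simp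

text \<open>Sigma-finiteness makes Fubini's theorem available. The point \<open>0\<close> is a null set, and away from it the
  integrable function \<open>min 1 ((norm y)\<^sup>2)\<close> is positive, so that Markov's inequality bounds its
  superlevel sets.\<close>

lemma sigma_finite_\<nu>: "sigma_finite_measure \<nu>"
proof
  \<comment> \<open>The superlevel set of \<open>min 1 ((norm y)\<^sup>2)\<close> at height \<open>1 / n\<close>.\<close>
  define A where "A n = {y :: real^'n. 1 \<le> of_nat n * ennreal (min 1 ((norm y)\<^sup>2))}" for n :: nat
  have A: "A n \<in> sets \<nu>" for n unfolding A_def by measurable
  have fin: "emeasure \<nu> (A n) \<noteq> \<infinity>" for n
  proof -
    have "emeasure \<nu> (A n) \<le> of_nat n * (\<integral>\<^sup>+ y. ennreal (min 1 ((norm y)\<^sup>2)) * indicator UNIV y \<partial>\<nu>)"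
      using nn_integral_Markov_inequality[of "\<lambda>y. ennreal (min 1 ((norm y)\<^sup>2))" UNIV \<nu> "of_nat n"]
      by (simp add: A_def)
    also have "\<dots> < \<infinity>" using \<nu>_moment by (simp add: ennreal_mult_less_top of_nat_less_top)
    finally show ?thesis by simp
  qed
  have "\<Union> (insert {0} (range A)) = UNIV"
  proof -
    have "\<exists>n. y \<in> A n" if "y \<noteq> 0" for y
    proof -
      have pos: "0 < min 1 ((norm y)\<^sup>2)" using that by simp
      obtain n :: nat where "1 / min 1 ((norm y)\<^sup>2) \<le> real n" using real_arch_simple by blast
      then have "1 \<le> real n * min 1 ((norm y)\<^sup>2)" using pos by (simp add: field_simps)
      then have "ennreal 1 \<le> ennreal (real n * min 1 ((norm y)\<^sup>2))" by (rule ennreal_leI)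
      then have "y \<in> A n" using pos by (simp add: A_def ennreal_mult ennreal_of_nat_eq_real_of_nat)
      then show ?thesis ..
    qed
    then show ?thesis by auto
  qed
  then show "\<exists>\<A>. countable \<A> \<and> \<A> \<subseteq> sets \<nu> \<and> \<Union> \<A> = space \<nu> \<and> (\<forall>a\<in>\<A>. emeasure \<nu> a \<noteq> \<infinity>)"
    using A fin \<nu>_zero sets_\<nu> by (intro exI[of _ "insert {0} (range A)"]) auto
qed

lemma integrable_truncated_square: "integrable \<nu> (\<lambda>y. min 1 ((norm y)\<^sup>2))"
  using \<nu>_moment by (intro integrableI_nonneg) auto

definition levy_khintchine_integrand :: "real^'n \<Rightarrow> real^'n \<Rightarrow> complex" where
  "levy_khintchine_integrand \<xi> y = 1 - iexp (\<xi> \<bullet> y) + \<i> * complex_of_real (\<xi> \<bullet> y) * indicator (ball 0 1) y"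

lemma Re_lk_integrand: "Re (levy_khintchine_integrand \<xi> y) = 1 - cos (\<xi> \<bullet> y)"
  by (cases "y \<in> ball 0 1") (simp_all add: levy_khintchine_integrand_def Re_exp)

text \<open>Near the origin the compensator leaves a Taylor remainder of second order, and away from it the integrand
  is bounded by \<open>2\<close>.\<close>

lemma integrable_lk_integrand: "integrable \<nu> (levy_khintchine_integrand \<xi>)"
proof (rule Bochner_Integration.integrable_bound)
  show "integrable \<nu> (\<lambda>y. (2 + (norm \<xi>)\<^sup>2) * min 1 ((norm y)\<^sup>2))"
    using integrable_truncated_square by simp
  show "levy_khintchine_integrand \<xi> \<in> borel_measurable \<nu>"
  proof -
    have "levy_khintchine_integrand \<xi> = (\<lambda>y. 1 - iexp (\<xi> \<bullet> y) +
        (if norm y < 1 then \<i> * complex_of_real (\<xi> \<bullet> y) else 0))"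
      by (auto simp: levy_khintchine_integrand_def fun_eq_iff)
    then show ?thesis by simp
  qed
  have "cmod (levy_khintchine_integrand \<xi> y) \<le> (2 + (norm \<xi>)\<^sup>2) * min 1 ((norm y)\<^sup>2)" for y
  proof (cases "norm y < 1")
    case True
    then have "cmod (levy_khintchine_integrand \<xi> y) = cmod (iexp (\<xi> \<bullet> y) - (\<Sum>k\<le>1. (\<i> * (\<xi> \<bullet> y))^k / fact k))"
      by (subst norm_minus_commute) (simp add: levy_khintchine_integrand_def atMost_Suc algebra_simps)
    also have "\<dots> \<le> \<bar>\<xi> \<bullet> y\<bar> ^ Suc 1 / fact (Suc 1)" by (rule iexp_approx1)
    also have "\<dots> = \<bar>\<xi> \<bullet> y\<bar>\<^sup>2 / 2" by (simp add: numeral_2_eq_2)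
    also have "\<dots> \<le> (norm \<xi> * norm y)\<^sup>2 / 2"
      by (intro divide_right_mono power_mono Cauchy_Schwarz_ineq2) auto
    also have "\<dots> \<le> (2 + (norm \<xi>)\<^sup>2) * (norm y)\<^sup>2"
      by (simp add: power_mult_distrib algebra_simps)
    also have "(norm y)\<^sup>2 = min 1 ((norm y)\<^sup>2)"
      using True using power_le_one[of "norm y" 2] by (simp add: min_def)
    finally show ?thesis by (simp add: mult.commute)
  next
    case False
    then have "cmod (levy_khintchine_integrand \<xi> y) \<le> 2"
      using norm_triangle_ineq4[of 1 "iexp (\<xi> \<bullet> y)"] by (simp add: levy_khintchine_integrand_def)
    moreover have "min 1 ((norm y)\<^sup>2) = 1" using False by (simp add: min_def abs_square_le_1)
    ultimately show ?thesis by (simp add: add_increasing2)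
  qed
  then show "AE y in \<nu>. cmod (levy_khintchine_integrand \<xi> y) \<le> norm ((2 + (norm \<xi>)\<^sup>2) * min 1 ((norm y)\<^sup>2))"
    by (intro AE_I2) (simp add: abs_mult)
qed

lemma integrable_one_minus_cos: "integrable \<nu> (\<lambda>y. 1 - cos (\<xi> \<bullet> y))"
proof -
  have "integrable \<nu> (\<lambda>y. Re (levy_khintchine_integrand \<xi> y))" by (intro integrable_Re integrable_lk_integrand)
  then show ?thesis by (simp add: Re_lk_integrand)
qed

lemma Re_exponent:
  "Re (\<psi> \<xi>) = (1/2) * (\<xi> \<bullet> (C *v \<xi>)) + (\<integral>y. 1 - cos (\<xi> \<bullet> y) \<partial>\<nu>)"
proof -
  have "Re (\<integral>y. levy_khintchine_integrand \<xi> y \<partial>\<nu>) = (\<integral>y. Re (levy_khintchine_integrand \<xi> y) \<partial>\<nu>)"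
    by (rule integral_Re[symmetric]) (rule integrable_lk_integrand)
  also have "\<dots> = (\<integral>y. 1 - cos (\<xi> \<bullet> y) \<partial>\<nu>)"
    by (intro Bochner_Integration.integral_cong) (auto simp: Re_lk_integrand)
  finally show ?thesis by (simp add: exponent levy_khintchine_integrand_def)
qed

lemma ennreal_Re_exponent:
  "ennreal (Re (\<psi> \<xi>)) = ennreal ((1/2) * (\<xi> \<bullet> (C *v \<xi>))) + (\<integral>\<^sup>+ y. ennreal (1 - cos (\<xi> \<bullet> y)) \<partial>\<nu>)"
  using C_nonneg[of \<xi>] unfolding Re_exponent
  by (subst nn_integral_eq_integral[OF integrable_one_minus_cos]) (auto intro!: ennreal_plus)

lemma Re_exponent_nonneg: "0 \<le> Re (\<psi> \<xi>)"
  unfolding Re_exponent using C_nonneg[of \<xi>] by (intro add_nonneg_nonneg) auto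

text \<open>Second differences cancel the drift and the compensator and leave, up to a constant, the Fourier transform
  of the finite measure with density \<open>2 * (1 - cos (\<eta> \<bullet> y))\<close> with respect to \<open>\<nu>\<close>.
  Thus \<open>\<psi>\<close> determines this measure.\<close>

lemma second_difference:
  "\<psi> (\<xi> + \<eta>) + \<psi> (\<xi> - \<eta>) - 2 * \<psi> \<xi>
     = complex_of_real (\<eta> \<bullet> (C *v \<eta>))
       + (\<integral>y. iexp (\<xi> \<bullet> y) * complex_of_real (2 * (1 - cos (\<eta> \<bullet> y))) \<partial>\<nu>)"
proof -
  have "(\<integral>y. iexp (\<xi> \<bullet> y) * complex_of_real (2 * (1 - cos (\<eta> \<bullet> y))) \<partial>\<nu>)
      = (\<integral>y. levy_khintchine_integrand (\<xi> + \<eta>) y + levy_khintchine_integrand (\<xi> - \<eta>) y - 2 * levy_khintchine_integrand \<xi> y \<partial>\<nu>)"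
  proof (rule Bochner_Integration.integral_cong[OF refl])
    fix y
    show "iexp (\<xi> \<bullet> y) * complex_of_real (2 * (1 - cos (\<eta> \<bullet> y)))
        = levy_khintchine_integrand (\<xi> + \<eta>) y + levy_khintchine_integrand (\<xi> - \<eta>) y - 2 * levy_khintchine_integrand \<xi> y"
      using iexp_add_iexp_diff[of "\<xi> \<bullet> y" "\<eta> \<bullet> y"]
      by (simp add: levy_khintchine_integrand_def inner_add_left inner_diff_left algebra_simps)
  qed
  also have "\<dots> = (\<integral>y. levy_khintchine_integrand (\<xi> + \<eta>) y \<partial>\<nu>) + (\<integral>y. levy_khintchine_integrand (\<xi> - \<eta>) y \<partial>\<nu>)
      - 2 * (\<integral>y. levy_khintchine_integrand \<xi> y \<partial>\<nu>)"
    by (simp add: integrable_lk_integrand)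
  finally have *: "(\<integral>y. iexp (\<xi> \<bullet> y) * complex_of_real (2 * (1 - cos (\<eta> \<bullet> y))) \<partial>\<nu>) = \<dots>" .
  have **: "(1/2) * ((\<xi> + \<eta>) \<bullet> (C *v (\<xi> + \<eta>))) + (1/2) * ((\<xi> - \<eta>) \<bullet> (C *v (\<xi> - \<eta>)))
      = \<xi> \<bullet> (C *v \<xi>) + \<eta> \<bullet> (C *v \<eta>)"
    by (simp add: matrix_vector_right_distrib matrix_vector_mult_diff_distrib
        inner_add_left inner_diff_left inner_add_right inner_diff_right field_simps)
  have "complex_of_real ((1/2) * ((\<xi> + \<eta>) \<bullet> (C *v (\<xi> + \<eta>))))
      + complex_of_real ((1/2) * ((\<xi> - \<eta>) \<bullet> (C *v (\<xi> - \<eta>))))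
      = complex_of_real (\<xi> \<bullet> (C *v \<xi>)) + complex_of_real (\<eta> \<bullet> (C *v \<eta>))"
    unfolding of_real_add[symmetric] ** ..
  then show ?thesis
    unfolding * exponent levy_khintchine_integrand_def[symmetric] 
    by (simp add: inner_add_left inner_diff_left algebra_simps)
qed

text \<open>The jump part inherits the inequality from the cosine, the Gaussian part satisfies it by the parallelogram
  law.\<close>

lemma Re_exponent_add: "Re (\<psi> (\<xi> + \<eta>)) \<le> 2 * Re (\<psi> \<xi>) + 2 * Re (\<psi> \<eta>)"
proof -
  have "(\<integral>y. 1 - cos ((\<xi> + \<eta>) \<bullet> y) \<partial>\<nu>) \<le> (\<integral>y. 2 * (1 - cos (\<xi> \<bullet> y)) + 2 * (1 - cos (\<eta> \<bullet> y)) \<partial>\<nu>)"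
    by (intro integral_mono integrable_one_minus_cos Bochner_Integration.integrable_add
        integrable_mult_right) (simp only: inner_add_left two_one_minus_cos_le)
  also have "\<dots> = 2 * (\<integral>y. 1 - cos (\<xi> \<bullet> y) \<partial>\<nu>) + 2 * (\<integral>y. 1 - cos (\<eta> \<bullet> y) \<partial>\<nu>)"
    by (subst Bochner_Integration.integral_add)
       (intro integrable_mult_right integrable_one_minus_cos, intro integrable_mult_right
          integrable_one_minus_cos, simp only: integral_mult_right_zero)
  finally have 1: "(\<integral>y. 1 - cos ((\<xi> + \<eta>) \<bullet> y) \<partial>\<nu>) \<le> \<dots>" .
  have "(\<xi> + \<eta>) \<bullet> (C *v (\<xi> + \<eta>)) + (\<xi> - \<eta>) \<bullet> (C *v (\<xi> - \<eta>))
      = 2 * (\<xi> \<bullet> (C *v \<xi>)) + 2 * (\<eta> \<bullet> (C *v \<eta>))"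
    by (simp add: matrix_vector_right_distrib matrix_vector_mult_diff_distrib
        inner_add_left inner_diff_left inner_add_right inner_diff_right)
  moreover have "(1/2) * a + i \<le> 2 * ((1/2) * a1 + i1) + 2 * ((1/2) * a2 + i2)"
    if "a + d = 2 * a1 + 2 * a2" "0 \<le> d" "i \<le> 2 * i1 + 2 * i2" for a d a1 a2 i i1 i2 :: real
    using that by simp
  ultimately show ?thesis unfolding Re_exponent using C_nonneg[of "\<xi> - \<eta>"] 1 by blast
qed

lemma Re_exponent_le:
  assumes "norm \<xi> \<le> \<rho>"
  shows "ennreal (Re (\<psi> \<xi>)) \<le> ennreal ((1/2) * (\<xi> \<bullet> (C *v \<xi>)))
     + 2 * (\<integral>\<^sup>+ y. ennreal (min 1 ((\<rho> * norm y)\<^sup>2)) \<partial>\<nu>)"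
proof -
  have "ennreal (1 - cos (\<xi> \<bullet> y)) \<le> ennreal 2 * ennreal (min 1 ((\<rho> * norm y)\<^sup>2))" for y
  proof -
    have "\<bar>\<xi> \<bullet> y\<bar> \<le> \<rho> * norm y"
      using Cauchy_Schwarz_ineq2[of \<xi> y] mult_right_mono[OF assms, of "norm y"] by simp
    then have "(\<xi> \<bullet> y)\<^sup>2 \<le> (\<rho> * norm y)\<^sup>2" by (rule abs_le_square_iff[THEN iffD1, OF order_trans]) simp
    then have "1 - cos (\<xi> \<bullet> y) \<le> 2 * min 1 ((\<rho> * norm y)\<^sup>2)"
      using one_minus_cos_le[of "\<xi> \<bullet> y"] by (smt (verit) min_def)
    then have "ennreal (1 - cos (\<xi> \<bullet> y)) \<le> ennreal (2 * min 1 ((\<rho> * norm y)\<^sup>2))" by (rule ennreal_leI)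
    also have "\<dots> = ennreal 2 * ennreal (min 1 ((\<rho> * norm y)\<^sup>2))" by (rule ennreal_mult) auto
    finally show ?thesis .
  qed
  then have "(\<integral>\<^sup>+ y. ennreal (1 - cos (\<xi> \<bullet> y)) \<partial>\<nu>)
      \<le> (\<integral>\<^sup>+ y. ennreal 2 * ennreal (min 1 ((\<rho> * norm y)\<^sup>2)) \<partial>\<nu>)"
    by (intro nn_integral_mono)
  also have "\<dots> = 2 * (\<integral>\<^sup>+ y. ennreal (min 1 ((\<rho> * norm y)\<^sup>2)) \<partial>\<nu>)"
    by (subst nn_integral_cmult) auto
  finally show ?thesis unfolding ennreal_Re_exponent by (rule add_left_mono)
qed

end

section \<open>Radial exponents in the plane\<close>

lemma norm_vec2: "norm (x::real^2) = sqrt ((x $ 1)\<^sup>2 + (x $ 2)\<^sup>2)"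
  by (simp add: norm_vec_def L2_set_def sum_2)

lemma axis_eq_scaleR: "(axis i h :: real^'n) = h *\<^sub>R axis i 1"
  by (simp add: vec_eq_iff axis_def)

lemma norm_axis_real: "norm (axis i (h::real)) = \<bar>h\<bar>"
  by (subst axis_eq_scaleR) simp

text \<open>A finite measure on the line whose Fourier transform is even is symmetric: after normalization this is the
  uniqueness theorem for characteristic functions, applied to the law of \<open>X\<close> and to its reflection.\<close>

lemma halves_eq_of_even_transform:
  fixes w X :: "'a \<Rightarrow> real"
  assumes w: "integrable M w" "\<And>y. 0 \<le> w y" and [measurable]: "X \<in> borel_measurable M"
    and even: "\<And>t. (\<integral>y. w y *\<^sub>R iexp (- t * X y) \<partial>M) = (\<integral>y. w y *\<^sub>R iexp (t * X y) \<partial>M)"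
  shows "(\<integral>\<^sup>+ y\<in>{y. 0 < X y}. ennreal (w y) \<partial>M) = (\<integral>\<^sup>+ y\<in>{y. X y < 0}. ennreal (w y) \<partial>M)"
proof -
  have [measurable]: "w \<in> borel_measurable M" using w(1) by simp
  define c where "c = (\<integral>y. w y \<partial>M)"
  have c: "(\<integral>\<^sup>+ y. ennreal (w y) \<partial>M) = ennreal c" unfolding c_def
    using w by (intro nn_integral_eq_integral) auto
  show ?thesis
  proof (cases "c > 0")
    case False
    then have "(\<integral>\<^sup>+ y. ennreal (w y) \<partial>M) = 0" using c by (simp add: ennreal_neg)
    moreover have "(\<integral>\<^sup>+ y\<in>A. ennreal (w y) \<partial>M) \<le> (\<integral>\<^sup>+ y. ennreal (w y) \<partial>M)" for A
      by (intro nn_integral_mono) (simp add: indicator_def)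
    ultimately have "(\<integral>\<^sup>+ y\<in>A. ennreal (w y) \<partial>M) = 0" for A by (metis le_zero_eq)
    then show ?thesis by simp
  next
    case True
    define D where "D = density M (\<lambda>y. ennreal (w y / c))"
    have [measurable_cong]: "sets D = sets M" by (simp add: D_def)
    have emD: "emeasure D A = ennreal (1 / c) * (\<integral>\<^sup>+ y\<in>A. ennreal (w y) \<partial>M)" if [measurable]: "A \<in> sets M" for A
    proof -
      have "emeasure D A = (\<integral>\<^sup>+ y. ennreal (1 / c) * (ennreal (w y) * indicator A y) \<partial>M)"
        unfolding D_def using True w(2)
        by (subst emeasure_density) (auto simp: ennreal_mult[symmetric] mult.assoc[symmetric] 
            intro!: nn_integral_cong)
      then show ?thesis by (simp add: nn_integral_cmult)
    qed
    interpret D: prob_space D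
    proof
      have "(\<integral>\<^sup>+ y\<in>space M. ennreal (w y) \<partial>M) = (\<integral>\<^sup>+ y. ennreal (w y) \<partial>M)"
        by (intro nn_integral_cong) simp
      then show "emeasure D (space D) = 1"
        using True emD[of "space M"] c by (simp add: D_def ennreal_mult[symmetric])
    qed
    have ch: "(CLINT y|D. iexp (t * X y)) = (1 / c) *\<^sub>R (\<integral>y. w y *\<^sub>R iexp (t * X y) \<partial>M)" for t
      unfolding D_def using True w(2)
      by (subst integral_density) (auto simp flip: integral_scaleR_right)
    have "distr D borel X = distr D borel (\<lambda>y. - X y)"
    proof (rule Levy_uniqueness)
      show "real_distribution (distr D borel X)" "real_distribution (distr D borel (\<lambda>y. - X y))"
        by (auto intro!: D.real_distribution_distr)
      show "char (distr D borel X) = char (distr D borel (\<lambda>y. - X y))"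
      proof
        fix t
        have "char (distr D borel X) t = (CLINT y|D. iexp (t * X y))"
          "char (distr D borel (\<lambda>y. - X y)) t = (CLINT y|D. iexp (- t * X y))"
          by (simp_all add: char_def integral_distr)
        then show "char (distr D borel X) t = char (distr D borel (\<lambda>y. - X y)) t"
          by (simp only: ch even)
      qed
    qed
    then have "emeasure (distr D borel X) {0<..} = emeasure (distr D borel (\<lambda>y. - X y)) {0<..}"
      by simp
    then have "emeasure D {y\<in>space M. 0 < X y} = emeasure D {y\<in>space M. X y < 0}"
      by (simp add: emeasure_distr vimage_def Int_def conj_commute D_def)
    then have "ennreal c * (ennreal (1 / c) * (\<integral>\<^sup>+ y\<in>{y\<in>space M. 0 < X y}. ennreal (w y) \<partial>M))
        = ennreal c * (ennreal (1 / c) * (\<integral>\<^sup>+ y\<in>{y\<in>space M. X y < 0}. ennreal (w y) \<partial>M))"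
      by (simp add: emD)
    then have "(\<integral>\<^sup>+ y\<in>{y\<in>space M. 0 < X y}. ennreal (w y) \<partial>M)
        = (\<integral>\<^sup>+ y\<in>{y\<in>space M. X y < 0}. ennreal (w y) \<partial>M)"
      using True by (simp add: ennreal_mult[symmetric] flip: mult.assoc)
    moreover have "(\<integral>\<^sup>+ y\<in>{y\<in>space M. P y}. ennreal (w y) \<partial>M) = (\<integral>\<^sup>+ y\<in>{y. P y}. ennreal (w y) \<partial>M)" for P
      by (intro nn_integral_cong) (simp add: indicator_def)
    ultimately show ?thesis by simp
  qed
qed

locale radial_levy_exponent = levy_exponent \<psi> b C \<nu>
  for \<psi> :: "real^2 \<Rightarrow> complex" and b C \<nu> +
  assumes radial: "\<And>R \<xi>. rotation_matrix R \<Longrightarrow> \<psi> (R *v \<xi>) = \<psi> \<xi>"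
begin

text \<open>Rotations of the plane act transitively on circles.\<close>

lemma exponent_cong_norm:
  assumes "norm \<xi> = norm \<eta>"
  shows "\<psi> \<xi> = \<psi> \<eta>"
proof -
  obtain f where f: "orthogonal_transformation f" "det (matrix f) = 1" "f \<xi> = \<eta>"
    using rotation_exists[of \<xi> \<eta>] assms by auto
  then have "rotation_matrix (matrix f)"
    by (simp add: rotation_matrix_def orthogonal_transformation_matrix)
  moreover have "matrix f *v \<xi> = \<eta>"
    using f by (simp add: orthogonal_transformation_linear matrix_works)
  ultimately show ?thesis using radial by metis
qed

text \<open>The dimension enters here: in the plane every vector of length at most \<open>2 * norm \<xi>\<close> is a sum of two
  vectors of length \<open>norm \<xi>\<close>, the sides of a rhombus with the given diagonal. So a radial exponent is,
  up to a factor, monotone, and its value at \<open>\<xi>\<close> controls its averages over smaller radii.\<close>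

lemma Re_exponent_le_of_norm_le:
  assumes "norm \<eta> \<le> 2 * norm \<xi>"
  shows "Re (\<psi> \<eta>) \<le> 4 * Re (\<psi> \<xi>)"
proof -
  define t where "t = norm \<eta> / 2"
  define s where "s = sqrt ((norm \<xi>)\<^sup>2 - t\<^sup>2)"
  have t: "0 \<le> t" "t\<^sup>2 \<le> (norm \<xi>)\<^sup>2" using assms by (auto simp: t_def intro!: power_mono)
  \<comment> \<open>The sides of the rhombus whose diagonal, on the first axis, is as long as \<open>\<eta>\<close>.\<close>
  have "norm (vector [t, s] :: real^2) = norm \<xi>" "norm (vector [t, - s] :: real^2) = norm \<xi>"
    using t by (simp_all add: norm_vec2 s_def)
  moreover have "norm (vector [t, s] + vector [t, - s] :: real^2) = norm \<eta>"
    by (simp add: norm_vec2 t_def)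
  ultimately show ?thesis
    using Re_exponent_add[of "vector [t, s]" "vector [t, - s]"]
    by (metis exponent_cong_norm mult_2 distrib_right numeral_Bit0)
qed

text \<open>By the preceding lemma \<open>4 * Re (\<psi> \<xi>)\<close> bounds the average of \<open>Re \<psi>\<close> over the segment from
  \<open>0\<close> to a vector of length \<open>norm \<xi>\<close> along the axis \<open>i\<close>, and the averaged cosine dominates
  \<open>min 1 ((norm \<xi> * y $ i)\<^sup>2) / 8\<close>.\<close>

lemma truncated_coordinate_le:
  "(\<integral>\<^sup>+ y. ennreal (min 1 ((norm \<xi> * y $ i)\<^sup>2)) \<partial>\<nu>) \<le> ennreal (32 * Re (\<psi> \<xi>))"
proof -
  interpret pair_sigma_finite \<nu> lborel
    using sigma_finite_\<nu> by (simp add: pair_sigma_finite_def sigma_finite_lborel)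
  have [measurable]: "(\<lambda>y::real^2. y $ i) \<in> borel_measurable borel" by simp
  define \<rho> where "\<rho> = norm \<xi>"
  have "(\<integral>\<^sup>+ y. ennreal (min 1 ((\<rho> * y $ i)\<^sup>2)) \<partial>\<nu>)
      = (\<integral>\<^sup>+ y. ennreal 8 * ennreal (min 1 ((\<rho> * y $ i)\<^sup>2) / 8) \<partial>\<nu>)"
    by (subst ennreal_mult[symmetric]) auto
  also have "\<dots> = ennreal 8 * (\<integral>\<^sup>+ y. ennreal (min 1 ((\<rho> * y $ i)\<^sup>2) / 8) \<partial>\<nu>)"
    by (rule nn_integral_cmult) measurable
  also have "(\<integral>\<^sup>+ y. ennreal (min 1 ((\<rho> * y $ i)\<^sup>2) / 8) \<partial>\<nu>)
      \<le> (\<integral>\<^sup>+ y. (\<integral>\<^sup>+ t\<in>{0..1}. ennreal (1 - cos (t * (\<rho> * y $ i))) \<partial>lborel) \<partial>\<nu>)"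
    by (intro nn_integral_mono nn_integral_one_minus_cos_ge)
  also have "\<dots> = (\<integral>\<^sup>+ t. \<integral>\<^sup>+ y. ennreal (1 - cos (t * (\<rho> * y $ i))) * indicator {0..1} t \<partial>\<nu> \<partial>lborel)"
    by (rule Fubini'[symmetric]) (simp add: indicator_def, measurable)
  also have "\<dots> \<le> (\<integral>\<^sup>+ t. ennreal (4 * Re (\<psi> \<xi>)) * indicator {0..1::real} t \<partial>lborel)"
  proof (rule nn_integral_mono)
    fix t :: real
    show "(\<integral>\<^sup>+ y. ennreal (1 - cos (t * (\<rho> * y $ i))) * indicator {0..1} t \<partial>\<nu>)
        \<le> ennreal (4 * Re (\<psi> \<xi>)) * indicator {0..1} t"
    proof (cases "t \<in> {0..1}")
      case True
      define \<eta> where "\<eta> = (t * \<rho>) *\<^sub>R (axis i 1 :: real^2)"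
      have "norm \<eta> \<le> 2 * norm \<xi>"
        using True mult_right_mono[of t 2 \<rho>] by (simp add: \<eta>_def \<rho>_def abs_mult)
      then have *: "Re (\<psi> \<eta>) \<le> 4 * Re (\<psi> \<xi>)" by (rule Re_exponent_le_of_norm_le)
      have "\<eta> \<bullet> y = t * (\<rho> * y $ i)" for y by (simp add: \<eta>_def inner_axis')
      then have "(\<integral>\<^sup>+ y. ennreal (1 - cos (t * (\<rho> * y $ i))) \<partial>\<nu>) \<le> ennreal (Re (\<psi> \<eta>))"
        by (simp add: ennreal_Re_exponent)
      also have "\<dots> \<le> ennreal (4 * Re (\<psi> \<xi>))" using * by (rule ennreal_leI)
      finally show ?thesis using True by simp
    qed simp
  qed
  also have "\<dots> = ennreal (4 * Re (\<psi> \<xi>))" by (simp add: nn_integral_cmult_indicator)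
  finally have "(\<integral>\<^sup>+ y. ennreal (min 1 ((\<rho> * y $ i)\<^sup>2)) \<partial>\<nu>) \<le> ennreal 8 * ennreal (4 * Re (\<psi> \<xi>))"
    by (simp add: mult_left_mono)
  also have "\<dots> = ennreal (32 * Re (\<psi> \<xi>))"
    using Re_exponent_nonneg by (subst ennreal_mult[symmetric]) auto
  finally show ?thesis unfolding \<rho>_def .
qed

text \<open>The two coordinates together control the norm. With the upper bound \<open>Re_exponent_le\<close> this shows that,
  up to the Gaussian part, a radial exponent is comparable to a truncated second moment of the Levy measure,
  a quantity that depends on the measure only through its tails.\<close>

lemma truncated_square_le:
  "(\<integral>\<^sup>+ y. ennreal (min 1 ((norm \<xi> * norm y)\<^sup>2)) \<partial>\<nu>) \<le> ennreal (64 * Re (\<psi> \<xi>))"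
proof -
  have "(\<integral>\<^sup>+ y. ennreal (min 1 ((norm \<xi> * norm y)\<^sup>2)) \<partial>\<nu>)
      \<le> (\<integral>\<^sup>+ y. ennreal (min 1 ((norm \<xi> * y $ 1)\<^sup>2)) + ennreal (min 1 ((norm \<xi> * y $ 2)\<^sup>2)) \<partial>\<nu>)"
  proof (rule nn_integral_mono)
    fix y :: "real^2"
    have "(norm \<xi> * norm y)\<^sup>2 = (norm \<xi> * y $ 1)\<^sup>2 + (norm \<xi> * y $ 2)\<^sup>2"
      by (simp add: norm_vec2 power_mult_distrib distrib_left)
    moreover have "min 1 (a + b) \<le> min 1 a + min 1 b" if "0 \<le> a" "0 \<le> b" for a b :: real
      using that by (simp add: min_def)
    ultimately have "min 1 ((norm \<xi> * norm y)\<^sup>2) \<le> min 1 ((norm \<xi> * y $ 1)\<^sup>2) + min 1 ((norm \<xi> * y $ 2)\<^sup>2)"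
      by simp
    then have "ennreal (min 1 ((norm \<xi> * norm y)\<^sup>2))
        \<le> ennreal (min 1 ((norm \<xi> * y $ 1)\<^sup>2) + min 1 ((norm \<xi> * y $ 2)\<^sup>2))"
      by (rule ennreal_leI)
    also have "\<dots> = ennreal (min 1 ((norm \<xi> * y $ 1)\<^sup>2)) + ennreal (min 1 ((norm \<xi> * y $ 2)\<^sup>2))"
      by (rule ennreal_plus) auto
    finally show "ennreal (min 1 ((norm \<xi> * norm y)\<^sup>2)) \<le> \<dots>" .
  qed
  also have "\<dots> \<le> ennreal (32 * Re (\<psi> \<xi>)) + ennreal (32 * Re (\<psi> \<xi>))"
    by (subst nn_integral_add) (auto intro!: add_mono truncated_coordinate_le)
  also have "\<dots> = ennreal (64 * Re (\<psi> \<xi>))"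
    using Re_exponent_nonneg by (subst ennreal_plus[symmetric]) auto
  finally show ?thesis .
qed

text \<open>The exponent is even because it is radial, hence so are its second differences; they are the Fourier
  transform of the projected measure weighted by \<open>2 * (1 - cos (h * y $ 1))\<close>, which is therefore symmetric.\<close>

lemma half_line_symmetry:
  "(\<integral>\<^sup>+ y\<in>{y. 0 < y $ 1}. ennreal (1 - cos (h * y $ 1)) \<partial>\<nu>)
     = (\<integral>\<^sup>+ y\<in>{y. y $ 1 < 0}. ennreal (1 - cos (h * y $ 1)) \<partial>\<nu>)"
proof (rule halves_eq_of_even_transform)
  define \<eta> :: "real^2" where "\<eta> = axis 1 h"
  have \<eta>: "\<eta> \<bullet> y = h * y $ 1" for y by (simp add: \<eta>_def inner_axis')
  show "integrable \<nu> (\<lambda>y. 1 - cos (h * y $ 1))"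
    using integrable_one_minus_cos[of \<eta>] by (simp add: \<eta>)
  fix t :: real
  define T where "T t = (\<integral>y. (1 - cos (h * y $ 1)) *\<^sub>R iexp (t * y $ 1) \<partial>\<nu>)" for t
  have T: "2 * T t = \<psi> (axis 1 (t + h)) + \<psi> (axis 1 (t - h)) - 2 * \<psi> (axis 1 t)
      - complex_of_real (\<eta> \<bullet> (C *v \<eta>))" for t
  proof -
    have "axis 1 t + \<eta> = axis 1 (t + h)" "axis 1 t - \<eta> = axis 1 (t - h)"
      by (simp_all add: \<eta>_def vec_eq_iff axis_def)
    moreover have "2 * T t = (\<integral>y. iexp (axis 1 t \<bullet> y) * complex_of_real (2 * (1 - cos (\<eta> \<bullet> y))) \<partial>\<nu>)"
      unfolding T_def integral_mult_right_zero[symmetric]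
      by (intro Bochner_Integration.integral_cong) (simp_all add: \<eta> inner_axis' scaleR_conv_of_real mult_ac)
    ultimately show ?thesis using second_difference[of "axis 1 t" \<eta>] by (simp add: algebra_simps)
  qed
  have "\<psi> (axis 1 (- t + h)) = \<psi> (axis 1 (t - h))" "\<psi> (axis 1 (- t - h)) = \<psi> (axis 1 (t + h))"
    "\<psi> (axis 1 (- t)) = \<psi> (axis 1 t)"
    by (intro exponent_cong_norm; simp add: norm_vec2 axis_def power2_eq_square algebra_simps)+
  then have "2 * T (- t) = 2 * T t" unfolding T by simp
  then show "(\<integral>y. (1 - cos (h * y $ 1)) *\<^sub>R iexp (- t * y $ 1) \<partial>\<nu>)
      = (\<integral>y. (1 - cos (h * y $ 1)) *\<^sub>R iexp (t * y $ 1) \<partial>\<nu>)"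
    by (simp add: T_def)
qed auto

lemma quadratic_part_le:
  "(1/2) * (axis 1 h \<bullet> (C *v axis 1 h)) \<le> h\<^sup>2 * Re (\<psi> (axis 1 1))"
proof -
  have "(1/2) * (axis 1 h \<bullet> (C *v axis 1 h)) = h\<^sup>2 * ((1/2) * (axis 1 1 \<bullet> (C *v axis 1 1)))"
    by (subst (1 2) axis_eq_scaleR) (simp add: matrix_vector_mult_scaleR power2_eq_square)
  also have "\<dots> \<le> h\<^sup>2 * Re (\<psi> (axis 1 1))"
    by (intro mult_left_mono) (simp_all add: Re_exponent)
  finally show ?thesis .
qed

lemma Re_exponent_le_radial:
  "ennreal (Re (\<psi> \<xi>)) \<le> ennreal ((norm \<xi>)\<^sup>2 * Re (\<psi> (axis 1 1)))
     + 4 * (\<integral>\<^sup>+ y\<in>{y. 0 < norm y}. ennreal (min 1 ((norm \<xi> * norm y)\<^sup>2)) \<partial>\<nu>)"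
proof -
  have "ennreal (Re (\<psi> \<xi>)) = ennreal (Re (\<psi> (axis 1 (norm \<xi>))))"
    by (subst exponent_cong_norm[of \<xi> "axis 1 (norm \<xi>)"]) (simp_all add: norm_axis_real)
  also have "\<dots> \<le> ennreal ((norm \<xi>)\<^sup>2 * Re (\<psi> (axis 1 1)))
     + 2 * (\<integral>\<^sup>+ y. ennreal (min 1 ((norm \<xi> * norm y)\<^sup>2)) \<partial>\<nu>)"
    by (rule order_trans[OF Re_exponent_le[of _ "norm \<xi>"]], simp add: norm_axis_real)
      (intro add_right_mono ennreal_leI quadratic_part_le)
  also have "\<dots> \<le> ennreal ((norm \<xi>)\<^sup>2 * Re (\<psi> (axis 1 1)))
     + 4 * (\<integral>\<^sup>+ y. ennreal (min 1 ((norm \<xi> * norm y)\<^sup>2)) \<partial>\<nu>)"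
    by (intro add_left_mono mult_right_mono) auto
  also have "(\<integral>\<^sup>+ y. ennreal (min 1 ((norm \<xi> * norm y)\<^sup>2)) \<partial>\<nu>)
      = (\<integral>\<^sup>+ y\<in>{y. 0 < norm y}. ennreal (min 1 ((norm \<xi> * norm y)\<^sup>2)) \<partial>\<nu>)"
    by (intro nn_integral_cong) (auto simp: indicator_def)
  finally show ?thesis .
qed

text \<open>The symmetry allows an upper bound by tails over right half-planes alone.\<close>

lemma Re_exponent_le_half_plane:
  "ennreal (Re (\<psi> \<xi>)) \<le> ennreal ((norm \<xi>)\<^sup>2 * Re (\<psi> (axis 1 1)))
     + 4 * (\<integral>\<^sup>+ y\<in>{y. 0 < y $ 1}. ennreal (min 1 ((norm \<xi> * y $ 1)\<^sup>2)) \<partial>\<nu>)"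
proof -
  define h where "h = norm \<xi>"
  have "ennreal (Re (\<psi> \<xi>)) = ennreal (Re (\<psi> (axis 1 h)))"
    unfolding h_def by (subst exponent_cong_norm[of \<xi> "axis 1 (norm \<xi>)"]) (simp_all add: norm_axis_real)
  also have "\<dots> = ennreal ((1/2) * (axis 1 h \<bullet> (C *v axis 1 h)))
      + (\<integral>\<^sup>+ y. ennreal (1 - cos (h * y $ 1)) \<partial>\<nu>)"
    by (simp add: ennreal_Re_exponent inner_axis')
  also have "(\<integral>\<^sup>+ y. ennreal (1 - cos (h * y $ 1)) \<partial>\<nu>)
      = (\<integral>\<^sup>+ y. ennreal (1 - cos (h * y $ 1)) * indicator {y. 0 < y $ 1} y
           + ennreal (1 - cos (h * y $ 1)) * indicator {y. y $ 1 < 0} y \<partial>\<nu>)"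
    by (intro nn_integral_cong) (auto simp: indicator_def not_less)
  also have "\<dots> = 2 * (\<integral>\<^sup>+ y\<in>{y. 0 < y $ 1}. ennreal (1 - cos (h * y $ 1)) \<partial>\<nu>)"
    by (subst nn_integral_add) (auto simp: half_line_symmetry[symmetric] mult_2)
  also have "(\<integral>\<^sup>+ y\<in>{y. 0 < y $ 1}. ennreal (1 - cos (h * y $ 1)) \<partial>\<nu>)
      \<le> (\<integral>\<^sup>+ y. ennreal 2 * (ennreal (min 1 ((h * y $ 1)\<^sup>2)) * indicator {y. 0 < y $ 1} y) \<partial>\<nu>)"
    unfolding mult.assoc[symmetric]
    by (intro nn_integral_mono mult_right_mono, subst ennreal_mult[symmetric])
       (auto intro!: ennreal_leI one_minus_cos_le)
  also have "\<dots> = 2 * (\<integral>\<^sup>+ y\<in>{y. 0 < y $ 1}. ennreal (min 1 ((h * y $ 1)\<^sup>2)) \<partial>\<nu>)"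
    by (subst nn_integral_cmult) auto
  also have "ennreal ((1/2) * (axis 1 h \<bullet> (C *v axis 1 h))) \<le> ennreal (h\<^sup>2 * Re (\<psi> (axis 1 1)))"
    by (intro ennreal_leI quadratic_part_le)
  finally show ?thesis unfolding h_def by (simp add: mult.assoc[symmetric] mult_left_mono add_mono)
qed

text \<open>Both the Gaussian part and the truncated second moment shrink at most quadratically as \<open>\<xi>\<close> tends to \<open>0\<close>. The
  constant collects \<open>1\<close> from the Gaussian part and \<open>2 * 64\<close> from the jumps.\<close>

lemma Re_exponent_quadratic_lower:
  assumes "norm \<xi> \<le> 1"
  shows "(norm \<xi>)\<^sup>2 * Re (\<psi> (axis 1 1)) \<le> 129 * Re (\<psi> \<xi>)"
proof -
  define h where "h = norm \<xi>"
  define m where "m = (\<integral>\<^sup>+ y. ennreal (min 1 ((norm y)\<^sup>2)) \<partial>\<nu>)"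
  define q1 where "q1 = (1/2) * (axis 1 1 \<bullet> (C *v axis 1 1))"
  have q1: "0 \<le> q1" unfolding q1_def using C_nonneg by simp
  have "h\<^sup>2 * q1 = (1/2) * (axis 1 h \<bullet> (C *v axis 1 h))"
    unfolding q1_def
    by (subst (3 4) axis_eq_scaleR) (simp add: matrix_vector_mult_scaleR power2_eq_square)
  also have "\<dots> \<le> Re (\<psi> (axis 1 h))" by (simp add: Re_exponent)
  also have "\<dots> = Re (\<psi> \<xi>)" by (subst exponent_cong_norm[of _ \<xi>]) (simp_all add: norm_axis_real h_def)
  finally have gauss: "h\<^sup>2 * q1 \<le> Re (\<psi> \<xi>)" .
  have "ennreal (h\<^sup>2) * m = (\<integral>\<^sup>+ y. ennreal (h\<^sup>2) * ennreal (min 1 ((norm y)\<^sup>2)) \<partial>\<nu>)"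
    unfolding m_def by (rule nn_integral_cmult[symmetric]) measurable
  also have "\<dots> \<le> (\<integral>\<^sup>+ y. ennreal (min 1 ((norm \<xi> * norm y)\<^sup>2)) \<partial>\<nu>)"
  proof (rule nn_integral_mono)
    fix y :: "real^2"
    have "h\<^sup>2 \<le> 1" using assms by (simp add: h_def power_le_one)
    then have "h\<^sup>2 * min 1 ((norm y)\<^sup>2) \<le> min 1 ((norm \<xi> * norm y)\<^sup>2)"
      using mult_mono[of "h\<^sup>2" 1 "min 1 ((norm y)\<^sup>2)" 1] mult_left_mono[of "min 1 ((norm y)\<^sup>2)" "(norm y)\<^sup>2" "h\<^sup>2"]
      by (simp add: h_def power_mult_distrib)
    then show "ennreal (h\<^sup>2) * ennreal (min 1 ((norm y)\<^sup>2)) \<le> ennreal (min 1 ((norm \<xi> * norm y)\<^sup>2))"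
      by (subst ennreal_mult[symmetric]) (auto intro: ennreal_leI)
  qed
  also have "\<dots> \<le> ennreal (64 * Re (\<psi> \<xi>))" by (rule truncated_square_le)
  finally have jumps: "ennreal (h\<^sup>2) * m \<le> ennreal (64 * Re (\<psi> \<xi>))" .
  have "ennreal (Re (\<psi> (axis 1 1))) \<le> ennreal q1 + 2 * m"
    using Re_exponent_le[of "axis 1 1" 1] by (simp add: q1_def m_def)
  then have "ennreal (h\<^sup>2) * ennreal (Re (\<psi> (axis 1 1))) \<le> ennreal (h\<^sup>2) * (ennreal q1 + 2 * m)"
    by (rule mult_left_mono) simp
  also have "\<dots> = ennreal (h\<^sup>2 * q1) + 2 * (ennreal (h\<^sup>2) * m)"
    using q1 by (simp add: distrib_left ennreal_mult mult.left_commute)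
  also have "\<dots> \<le> ennreal (Re (\<psi> \<xi>)) + 2 * ennreal (64 * Re (\<psi> \<xi>))"
    by (intro add_mono mult_left_mono jumps ennreal_leI gauss) simp
  also have "2 * ennreal (64 * Re (\<psi> \<xi>)) = ennreal 2 * ennreal (64 * Re (\<psi> \<xi>))" by simp
  also have "ennreal (Re (\<psi> \<xi>)) + ennreal 2 * ennreal (64 * Re (\<psi> \<xi>)) = ennreal (129 * Re (\<psi> \<xi>))"
    using Re_exponent_nonneg[of \<xi>]
    by (subst ennreal_mult[symmetric], simp, simp, subst ennreal_plus[symmetric]) auto
  finally show ?thesis
    using Re_exponent_nonneg by (simp add: h_def ennreal_mult[symmetric] ennreal_le_iff)
qed

end

section \<open>Comparison of two exponents through tails\<close>

text \<open>Jumps with \<open>f y > a\<close> are compared through the tails of \<open>f\<close>. The Gaussian part and the jumps with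
  \<open>f y \<le> a\<close> contribute at most a multiple of \<open>(norm \<xi>)\<^sup>2\<close>, whose size is measured by the value
  of the exponent at a unit vector. Allowing a general \<open>f\<close> covers tails outside balls and tails over
  half-planes at once.\<close>

lemma exponent_comparison:
  assumes "radial_levy_exponent \<psi> b C \<nu>" and "radial_levy_exponent \<psi>' b' C' \<nu>'"
    and f [measurable]: "f \<in> borel_measurable borel" and f_le: "\<And>y. f y \<le> norm y"
    and upper: "ennreal (Re (\<psi>' \<xi>)) \<le> ennreal ((norm \<xi>)\<^sup>2 * Re (\<psi>' (axis 1 1)))
      + 4 * (\<integral>\<^sup>+ y\<in>{y. 0 < f y}. ennreal (min 1 ((norm \<xi> * f y)\<^sup>2)) \<partial>\<nu>')"
    and a: "0 \<le> a" and tails: "\<And>u. a \<le> u \<Longrightarrow> emeasure \<nu>' {y. u < f y} \<le> emeasure \<nu> {y. u < f y}"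
  shows "Re (\<psi>' \<xi>) \<le> 256 * Re (\<psi> \<xi>) + (1 + 256 * (1 + a\<^sup>2)) * Re (\<psi>' (axis 1 1)) * (norm \<xi>)\<^sup>2"
proof -
  interpret L: radial_levy_exponent \<psi> b C \<nu> by fact
  interpret L': radial_levy_exponent \<psi>' b' C' \<nu>' by fact
  note [measurable_cong] = L.sets_\<nu> L'.sets_\<nu>
  define \<rho> where "\<rho> = norm \<xi>"
  define g where "g y = ennreal (min 1 ((\<rho> * f y)\<^sup>2))" for y
  define Q where "Q = Re (\<psi>' (axis 1 1))"
  have [measurable]: "g \<in> borel_measurable borel" unfolding g_def by measurable
  have Q: "0 \<le> Q" unfolding Q_def by (rule L'.Re_exponent_nonneg)
  show ?thesis
  proof (cases "\<xi> = 0")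
    case True
    then have "Re (\<psi>' \<xi>) = 0" by (simp add: L'.Re_exponent)
    then show ?thesis using True L.Re_exponent_nonneg[of \<xi>] by simp
  next
    case False
    then have \<rho>: "0 < \<rho>" by (simp add: \<rho>_def)
    have "(\<integral>\<^sup>+ y\<in>{y. a < f y}. g y \<partial>\<nu>') \<le> (\<integral>\<^sup>+ y\<in>{y. a < f y}. g y \<partial>\<nu>)"
      unfolding g_def
      by (rule nn_integral_truncated_square_mono)
        (use a \<rho> tails L.sigma_finite_\<nu> L'.sigma_finite_\<nu> L.sets_\<nu> L'.sets_\<nu> in auto)
    also have "\<dots> \<le> (\<integral>\<^sup>+ y. ennreal (min 1 ((\<rho> * norm y)\<^sup>2)) \<partial>\<nu>)"
    proof (rule nn_integral_mono)
      fix y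
      show "g y * indicator {y. a < f y} y \<le> ennreal (min 1 ((\<rho> * norm y)\<^sup>2))"
      proof (cases "a < f y")
        case True
        then have "(\<rho> * f y)\<^sup>2 \<le> (\<rho> * norm y)\<^sup>2"
          using a \<rho> f_le[of y] by (intro power_mono mult_left_mono) auto
        then show ?thesis using True by (auto simp: g_def intro!: ennreal_leI)
      qed simp
    qed
    also have "\<dots> \<le> ennreal (64 * Re (\<psi> \<xi>))" unfolding \<rho>_def by (rule L.truncated_square_le)
    finally have large: "(\<integral>\<^sup>+ y\<in>{y. a < f y}. g y \<partial>\<nu>') \<le> ennreal (64 * Re (\<psi> \<xi>))" .
    have "(\<integral>\<^sup>+ y\<in>{y. 0 < f y \<and> f y \<le> a}. g y \<partial>\<nu>')
        \<le> (\<integral>\<^sup>+ y. ennreal (\<rho>\<^sup>2 * (1 + a\<^sup>2)) * ennreal (min 1 ((norm y)\<^sup>2)) \<partial>\<nu>')"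
    proof (rule nn_integral_mono)
      fix y
      show "g y * indicator {y. 0 < f y \<and> f y \<le> a} y
          \<le> ennreal (\<rho>\<^sup>2 * (1 + a\<^sup>2)) * ennreal (min 1 ((norm y)\<^sup>2))"
      proof (cases "0 < f y \<and> f y \<le> a")
        case True
        then have "(f y)\<^sup>2 \<le> (norm y)\<^sup>2" "(f y)\<^sup>2 \<le> a\<^sup>2" using f_le[of y] by (auto intro: power_mono)
        then have "(f y)\<^sup>2 \<le> (1 + a\<^sup>2) * min 1 ((norm y)\<^sup>2)"
          by (simp add: min_def algebra_simps add_increasing2)
        then have "\<rho>\<^sup>2 * (f y)\<^sup>2 \<le> \<rho>\<^sup>2 * ((1 + a\<^sup>2) * min 1 ((norm y)\<^sup>2))" by (rule mult_left_mono) simp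
        then have "min 1 ((\<rho> * f y)\<^sup>2) \<le> (\<rho>\<^sup>2 * (1 + a\<^sup>2)) * min 1 ((norm y)\<^sup>2)"
          by (simp add: power_mult_distrib mult.assoc min.coboundedI2)
        then have "g y \<le> ennreal ((\<rho>\<^sup>2 * (1 + a\<^sup>2)) * min 1 ((norm y)\<^sup>2))"
          unfolding g_def by (rule ennreal_leI)
        then show ?thesis using True by (simp add: ennreal_mult)
      qed simp
    qed
    also have "\<dots> = ennreal (\<rho>\<^sup>2 * (1 + a\<^sup>2)) * (\<integral>\<^sup>+ y. ennreal (min 1 ((norm y)\<^sup>2)) \<partial>\<nu>')"
      by (rule nn_integral_cmult) measurable
    also have "\<dots> \<le> ennreal (\<rho>\<^sup>2 * (1 + a\<^sup>2)) * ennreal (64 * Q)"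
      using L'.truncated_square_le[of "axis 1 1"] by (intro mult_left_mono) (auto simp: Q_def)
    also have "\<dots> = ennreal (\<rho>\<^sup>2 * (1 + a\<^sup>2) * (64 * Q))" using Q by (simp add: ennreal_mult)
    finally have small: "(\<integral>\<^sup>+ y\<in>{y. 0 < f y \<and> f y \<le> a}. g y \<partial>\<nu>') \<le> ennreal (\<rho>\<^sup>2 * (1 + a\<^sup>2) * (64 * Q))" .
    have "(\<integral>\<^sup>+ y\<in>{y. 0 < f y}. g y \<partial>\<nu>')
        = (\<integral>\<^sup>+ y. g y * indicator {y. a < f y} y + g y * indicator {y. 0 < f y \<and> f y \<le> a} y \<partial>\<nu>')"
      using a by (intro nn_integral_cong) (auto simp: indicator_def)
    also have "\<dots> = (\<integral>\<^sup>+ y\<in>{y. a < f y}. g y \<partial>\<nu>') + (\<integral>\<^sup>+ y\<in>{y. 0 < f y \<and> f y \<le> a}. g y \<partial>\<nu>')"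
      by (rule nn_integral_add) measurable
    also have "\<dots> \<le> ennreal (64 * Re (\<psi> \<xi>)) + ennreal (\<rho>\<^sup>2 * (1 + a\<^sup>2) * (64 * Q))"
      by (rule add_mono[OF large small])
    also have "\<dots> = ennreal (64 * Re (\<psi> \<xi>) + \<rho>\<^sup>2 * (1 + a\<^sup>2) * (64 * Q))"
      using L.Re_exponent_nonneg Q by (intro ennreal_plus[symmetric]) auto
    finally have total: "(\<integral>\<^sup>+ y\<in>{y. 0 < f y}. g y \<partial>\<nu>') \<le> \<dots>" .
    have "ennreal (Re (\<psi>' \<xi>)) \<le> ennreal (\<rho>\<^sup>2 * Q) + 4 * (\<integral>\<^sup>+ y\<in>{y. 0 < f y}. g y \<partial>\<nu>')"
      using upper by (simp add: g_def \<rho>_def Q_def)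
    also have "\<dots> \<le> ennreal (\<rho>\<^sup>2 * Q) + ennreal 4 * ennreal (64 * Re (\<psi> \<xi>) + \<rho>\<^sup>2 * (1 + a\<^sup>2) * (64 * Q))"
      using total by (intro add_left_mono) (simp add: mult_left_mono)
    also have "\<dots> = ennreal (\<rho>\<^sup>2 * Q + 4 * (64 * Re (\<psi> \<xi>) + \<rho>\<^sup>2 * (1 + a\<^sup>2) * (64 * Q)))"
      using L.Re_exponent_nonneg[of \<xi>] Q
      by (subst ennreal_mult[symmetric], simp, simp, subst ennreal_plus[symmetric]) auto
    finally have "Re (\<psi>' \<xi>) \<le> \<rho>\<^sup>2 * Q + 4 * (64 * Re (\<psi> \<xi>) + \<rho>\<^sup>2 * (1 + a\<^sup>2) * (64 * Q))"
      using L.Re_exponent_nonneg[of \<xi>] Q by (subst (asm) ennreal_le_iff) auto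
    also have "\<dots> = 256 * Re (\<psi> \<xi>) + (1 + 256 * (1 + a\<^sup>2)) * Q * \<rho>\<^sup>2" by (simp add: algebra_simps)
    finally show ?thesis by (simp add: \<rho>_def Q_def)
  qed
qed

text \<open>Passes from the closed tails \<open>- ball 0 u\<close> to the open tails of the layer-cake argument.\<close>

lemma emeasure_norm_greater:
  assumes "sets \<mu> = sets (borel :: 'a::euclidean_space measure)"
  shows "emeasure \<mu> {y. u < norm y} = (SUP n. emeasure \<mu> (- ball 0 (u + 1 / real (Suc n))))"
proof -
  have "(SUP n. emeasure \<mu> (- ball (0::'a) (u + 1 / real (Suc n))))
      = emeasure \<mu> (\<Union>n. - ball (0::'a) (u + 1 / real (Suc n)))"
  proof (rule SUP_emeasure_incseq)
    show "range (\<lambda>n. - ball (0::'a) (u + 1 / real (Suc n))) \<subseteq> sets \<mu>"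
      unfolding assms by (auto intro!: borel_closed)
    show "incseq (\<lambda>n. - ball (0::'a) (u + 1 / real (Suc n)))"
    proof (rule monoI)
      fix m n :: nat assume "m \<le> n"
      then have "1 / real (Suc n) \<le> 1 / real (Suc m)" by (intro divide_left_mono) auto
      then show "- ball (0::'a) (u + 1 / real (Suc m)) \<le> - ball 0 (u + 1 / real (Suc n))" by auto
    qed
  qed
  also have "(\<Union>n. - ball (0::'a) (u + 1 / real (Suc n))) = {y. u < norm y}"
  proof (intro set_eqI iffI)
    fix y :: 'a assume "y \<in> {y. u < norm y}"
    then obtain n where "1 / real (Suc n) < norm y - u"
      using reals_Archimedean[of "norm y - u"] by (auto simp: inverse_eq_divide)
    then show "y \<in> (\<Union>n. - ball 0 (u + 1 / real (Suc n)))" by (auto intro!: exI[of _ n])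
  next
    fix y :: 'a assume "y \<in> (\<Union>n. - ball 0 (u + 1 / real (Suc n)))"
    then obtain n where "u + 1 / real (Suc n) \<le> norm y"
      by (auto simp: not_less simp del: of_nat_Suc)
    moreover have "0 < 1 / real (Suc n)" by simp
    ultimately show "y \<in> {y. u < norm y}" by (simp only: mem_Collect_eq)
  qed
  finally show ?thesis by simp
qed

section \<open>Comparison of the integral tests\<close>

lemma nn_integral_reciprocal_ball_le:
  fixes s t :: "'a::euclidean_space \<Rightarrow> ennreal"
  assumes "0 < B" "\<rho> \<le> r" and le: "\<And>\<xi>. norm \<xi> < \<rho> \<Longrightarrow> t \<xi> \<le> ennreal B * s \<xi>"
  shows "(\<integral>\<^sup>+ \<xi>\<in>ball 0 \<rho>. 1 / s \<xi> \<partial>M) \<le> ennreal B * (\<integral>\<^sup>+ \<xi>\<in>ball 0 r. 1 / t \<xi> \<partial>M)"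
proof -
  have "(\<integral>\<^sup>+ \<xi>\<in>ball 0 \<rho>. 1 / s \<xi> \<partial>M) \<le> (\<integral>\<^sup>+ \<xi>. ennreal B * (1 / t \<xi> * indicator (ball 0 r) \<xi>) \<partial>M)"
  proof (rule nn_integral_mono)
    fix \<xi>
    show "1 / s \<xi> * indicator (ball 0 \<rho>) \<xi> \<le> ennreal B * (1 / t \<xi> * indicator (ball 0 r) \<xi>)"
    proof (cases "norm \<xi> < \<rho>")
      case True
      then show ?thesis using ennreal_reciprocal_le_scale[OF assms(1) le[OF True]] assms(2) by simp
    qed simp
  qed
  also have "\<dots> \<le> ennreal B * (\<integral>\<^sup>+ \<xi>\<in>ball 0 r. 1 / t \<xi> \<partial>M)"
    by (rule nn_integral_cmult_le[OF assms(1)])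
  finally show ?thesis .
qed

lemma levy_measure_radial_exponent:
  assumes "levy_measure q \<nu>" and "radial_in_covariable q"
  obtains b C where "\<And>x. radial_levy_exponent (q x) (b x) (C x) (\<nu> x)"
proof -
  obtain b C where *: "levy_triplet q b C \<nu>" using assms(1) by (auto simp: levy_measure_def)
  have "radial_levy_exponent (q x) (b x) (C x) (\<nu> x)" for x
    using * assms(2) unfolding levy_triplet_def radial_in_covariable_def
    by unfold_locales auto
  then show ?thesis by (rule that)
qed

text \<open>The growth bound on \<open>q'\<close> makes its values at unit vectors bounded in the state, so that the comparison of
  exponents holds with one constant for all states.\<close>

lemma symbol_comparison:
  fixes q q' :: "real^2 \<Rightarrow> real^2 \<Rightarrow> complex"
  assumes q: "levy_measure q \<nu>" "radial_in_covariable q"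
    and q': "levy_measure q' \<nu>'" "radial_in_covariable q'"
    and K: "\<And>x \<xi>. cmod (q' x \<xi>) \<le> K * (1 + (norm \<xi>)\<^sup>2)"
    and tails: "(\<exists>u\<^sub>0\<ge>0. \<forall>x. \<forall>u\<ge>u\<^sub>0. emeasure (\<nu> x) (- ball 0 u) \<ge> emeasure (\<nu>' x) (- ball 0 u)) \<or>
         (\<exists>u\<^sub>0\<ge>0. \<forall>x. \<forall>u\<ge>u\<^sub>0. emeasure (\<nu> x) {y. y $ 1 > u} \<ge> emeasure (\<nu>' x) {y. y $ 1 > u})"
  obtains A where "0 < A" "\<And>x \<xi>. Re (q' x \<xi>) \<le> A * (Re (q x \<xi>) + (norm \<xi>)\<^sup>2)"
proof -
  obtain b C where L: "\<And>x. radial_levy_exponent (q x) (b x) (C x) (\<nu> x)"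
    using levy_measure_radial_exponent[OF q] by blast
  obtain b' C' where L': "\<And>x. radial_levy_exponent (q' x) (b' x) (C' x) (\<nu>' x)"
    using levy_measure_radial_exponent[OF q'] by blast
  note le = levy_exponent.sets_\<nu>[OF radial_levy_exponent.axioms(1)]
  have "\<exists>a\<ge>0. \<forall>x \<xi>. Re (q' x \<xi>)
      \<le> 256 * Re (q x \<xi>) + (1 + 256 * (1 + a\<^sup>2)) * Re (q' x (axis 1 1)) * (norm \<xi>)\<^sup>2"
    using tails
  proof (elim disjE exE conjE)
    fix a :: real
    assume a: "0 \<le> a"
      and balls: "\<forall>x. \<forall>u\<ge>a. emeasure (\<nu>' x) (- ball 0 u) \<le> emeasure (\<nu> x) (- ball 0 u)"
    have "emeasure (\<nu>' x) {y. u < norm y} \<le> emeasure (\<nu> x) {y. u < norm y}" if "a \<le> u" for x u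
      unfolding emeasure_norm_greater[OF le[OF L]] emeasure_norm_greater[OF le[OF L']]
      by (intro SUP_mono') (use that in \<open>auto intro!: balls[rule_format] add_increasing2\<close>)
    then show ?thesis
      using exponent_comparison[OF L L', of norm _ _ a]
        radial_levy_exponent.Re_exponent_le_radial[OF L'] a by (intro exI[of _ a]) auto
  next
    fix a :: real
    assume a: "0 \<le> a"
      and halves: "\<forall>x. \<forall>u\<ge>a. emeasure (\<nu>' x) {y. u < y $ 1} \<le> emeasure (\<nu> x) {y. u < y $ 1}"
    have "y $ 1 \<le> norm y" for y :: "real^2" using component_le_norm_cart[of y 1] by linarith
    then show ?thesis
      using exponent_comparison[OF L L', of "\<lambda>y. y $ 1" _ _ a]
        radial_levy_exponent.Re_exponent_le_half_plane[OF L'] a halves by (intro exI[of _ a]) auto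
  qed
  then obtain a where a: "0 \<le> a" and bound: "\<And>x \<xi>. Re (q' x \<xi>)
      \<le> 256 * Re (q x \<xi>) + (1 + 256 * (1 + a\<^sup>2)) * Re (q' x (axis 1 1)) * (norm \<xi>)\<^sup>2" by blast
  \<comment> \<open>Large enough for the factor of \<open>Re (q x \<xi>)\<close> and, as \<open>Re (q' x \<xi>) \<le> 2 * K\<close> at unit vectors, for that of
    \<open>(norm \<xi>)\<^sup>2\<close>.\<close>
  define A where "A = max 256 ((1 + 256 * (1 + a\<^sup>2)) * (2 * K))"
  have "Re (q' x \<xi>) \<le> A * (Re (q x \<xi>) + (norm \<xi>)\<^sup>2)" for x \<xi>
  proof -
    have "Re (q' x (axis 1 1)) \<le> 2 * K"
      using K[of x "axis 1 1"] complex_Re_le_cmod[of "q' x (axis 1 1)"] by simp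
    then have "(1 + 256 * (1 + a\<^sup>2)) * Re (q' x (axis 1 1)) \<le> (1 + 256 * (1 + a\<^sup>2)) * (2 * K)"
      by (intro mult_left_mono) auto
    then have "(1 + 256 * (1 + a\<^sup>2)) * Re (q' x (axis 1 1)) * (norm \<xi>)\<^sup>2 \<le> A * (norm \<xi>)\<^sup>2"
      by (intro mult_right_mono) (auto simp: A_def)
    moreover have "0 \<le> Re (q x \<xi>)"
      using levy_exponent.Re_exponent_nonneg[OF radial_levy_exponent.axioms(1)[OF L]] .
    then have "256 * Re (q x \<xi>) \<le> A * Re (q x \<xi>)" by (intro mult_right_mono) (simp add: A_def)
    ultimately show ?thesis using bound[of x \<xi>] unfolding distrib_left by linarith
  qed
  moreover have "0 < A" by (simp add: A_def)
  ultimately show ?thesis using that by blast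
qed

theorem theorem5p1:
  fixes M :: "'w measure" and F :: "real \<Rightarrow> 'w \<Rightarrow> real^2" and P :: "real^2 \<Rightarrow> 'w measure"
    and M' :: "'v measure" and F' :: "real \<Rightarrow> 'v \<Rightarrow> real^2" and P' :: "real^2 \<Rightarrow> 'v measure"
    and q q' :: "real^2 \<Rightarrow> real^2 \<Rightarrow> complex"
    and \<nu> \<nu>' :: "real^2 \<Rightarrow> (real^2) measure"
  assumes "levy_type_process M F P q" and "open_set_irreducible M F P"
    and "levy_type_process M' F' P' q'" and "open_set_irreducible M' F' P'"
    and "radial_in_covariable q" and "radial_in_covariable q'"
    and "levy_measure q \<nu>" and "levy_measure q' \<nu>'"
    and "\<exists>v\<^sub>0\<ge>0. \<forall>x. quasi_unimodal v\<^sub>0 (proj1 (\<nu> x))"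
    and "(\<exists>u\<^sub>0\<ge>0. \<forall>x. \<forall>u\<ge>u\<^sub>0. emeasure (\<nu> x) (- ball 0 u) \<ge> emeasure (\<nu>' x) (- ball 0 u)) \<or>
         (\<exists>u\<^sub>0\<ge>0. \<forall>x. \<forall>u\<ge>u\<^sub>0. emeasure (\<nu> x) {y. y $ 1 > u} \<ge> emeasure (\<nu>' x) {y. y $ 1 > u})"
  shows "((\<forall>r>0. (\<integral>\<^sup>+ \<xi>\<in>ball 0 r. 1 / sup_symbol q \<xi> \<partial>lborel) = \<infinity>) \<longrightarrow>
         (\<forall>r>0. (\<integral>\<^sup>+ \<xi>\<in>ball 0 r. 1 / sup_symbol q' \<xi> \<partial>lborel) = \<infinity>)) \<and>
         (Liminf (at 0) (\<lambda>\<xi>. INF x. \<integral>\<^sup>+ y. ennreal ((1 - cos (\<xi> \<bullet> y)) / (norm \<xi>)\<^sup>2) \<partial>\<nu> x) = \<infinity> \<longrightarrow>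
         (\<exists>r>0. (\<integral>\<^sup>+ \<xi>\<in>ball 0 r. 1 / inf_symbol q' \<xi> \<partial>lborel) < \<infinity>) \<longrightarrow>
         (\<exists>r>0. (\<integral>\<^sup>+ \<xi>\<in>ball 0 r. 1 / inf_symbol q \<xi> \<partial>lborel) < \<infinity>))"
proof (intro conjI impI allI)
  obtain K where K: "\<And>x \<xi>. cmod (q' x \<xi>) \<le> K * (1 + (norm \<xi>)\<^sup>2)"
    using levy_type_process.bounded_coefficients[OF assms(3)] by blast
  obtain A where A: "0 < A" and comparison: "\<And>x \<xi>. Re (q' x \<xi>) \<le> A * (Re (q x \<xi>) + (norm \<xi>)\<^sup>2)"
    using symbol_comparison[OF assms(7,5,8,6) K assms(10)] by blast
  obtain b C where L: "\<And>x. radial_levy_exponent (q x) (b x) (C x) (\<nu> x)"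
    using levy_measure_radial_exponent[OF assms(7,5)] by blast
  note levy = radial_levy_exponent.axioms(1)[OF L]
  note nonneg = levy_exponent.Re_exponent_nonneg[OF levy]
  {
    assume div: "\<forall>r>0. (\<integral>\<^sup>+ \<xi>\<in>ball 0 r. 1 / sup_symbol q \<xi> \<partial>lborel) = \<infinity>"
    \<comment> \<open>If some exponent is not zero, the supremum for \<open>q\<close> absorbs \<open>(norm \<xi>)\<^sup>2\<close> and serves as \<open>s\<close>;
      otherwise \<open>s \<xi> = (norm \<xi>)\<^sup>2\<close>, whose reciprocal is not integrable in the plane.\<close>
    have "\<exists>B>0. \<exists>s. (\<forall>r>0. (\<integral>\<^sup>+ \<xi>\<in>ball 0 r. 1 / s \<xi> \<partial>lborel) = \<infinity>) \<and>
        (\<forall>\<xi>. norm \<xi> < 1 \<longrightarrow> sup_symbol q' \<xi> \<le> ennreal B * s \<xi>)"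
    proof (cases "\<exists>x. 0 < Re (q x (axis 1 1))")
      case True
      then obtain z where z: "0 < Re (q z (axis 1 1))" by blast
      define c where "c = Re (q z (axis 1 1))"
      define d where "d = 129 / c"
      have d: "0 < d" using z by (simp add: d_def c_def)
      define B where "B = A * (1 + d)"
      have B: "0 < B" using A d by (simp add: B_def)
      have "sup_symbol q' \<xi> \<le> ennreal B * sup_symbol q \<xi>" if "norm \<xi> < 1" for \<xi>
      proof -
        have upper: "ennreal (Re (q x \<xi>)) \<le> sup_symbol q \<xi>" for x
          unfolding sup_symbol_def by (rule SUP_upper) simp
        have "(norm \<xi>)\<^sup>2 * c \<le> 129 * Re (q z \<xi>)"
          unfolding c_def using radial_levy_exponent.Re_exponent_quadratic_lower[OF L] that by simp
        then have sq: "(norm \<xi>)\<^sup>2 \<le> d * Re (q z \<xi>)"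
          using z by (simp add: d_def c_def field_simps)
        show ?thesis unfolding sup_symbol_def[of q']
        proof (rule SUP_least)
          fix x
          have "Re (q' x \<xi>) \<le> A * (Re (q x \<xi>) + d * Re (q z \<xi>))"
            by (rule order_trans[OF comparison]) (use A sq in auto)
          then have "ennreal (Re (q' x \<xi>)) \<le> ennreal (A * (Re (q x \<xi>) + d * Re (q z \<xi>)))"
            by (rule ennreal_leI)
          also have "\<dots> = ennreal A * (ennreal (Re (q x \<xi>)) + ennreal d * ennreal (Re (q z \<xi>)))"
            using A d nonneg by (simp add: ennreal_mult ennreal_plus)
          also have "\<dots> \<le> ennreal A * (sup_symbol q \<xi> + ennreal d * sup_symbol q \<xi>)"
            by (intro mult_left_mono add_mono upper) auto
          also have "\<dots> = ennreal A * (ennreal 1 + ennreal d) * sup_symbol q \<xi>"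
            by (simp only: ennreal_1 mult_1 distrib_left distrib_right mult.assoc mult_1_right)
          also have "ennreal A * (ennreal 1 + ennreal d) = ennreal B"
            unfolding B_def using A d
            by (subst ennreal_mult, simp, simp, subst ennreal_plus, simp_all)
          finally show "ennreal (Re (q' x \<xi>)) \<le> ennreal B * sup_symbol q \<xi>" .
        qed
      qed
      then show ?thesis using B div by blast
    next
      case False
      have "sup_symbol q' \<xi> \<le> ennreal A * ennreal ((norm \<xi>)\<^sup>2)" if "norm \<xi> < 1" for \<xi>
        unfolding sup_symbol_def
      proof (rule SUP_least)
        fix x
        have "Re (q x (axis 1 1)) \<le> 0" using False by (simp add: not_less)
        moreover have "Re (q x \<xi>) \<le> 4 * Re (q x (axis 1 1))"
          using radial_levy_exponent.Re_exponent_le_of_norm_le[OF L, of \<xi> "axis 1 1"] that by simp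
        ultimately have "Re (q x \<xi>) \<le> 0" by linarith
        then have "Re (q' x \<xi>) \<le> A * (norm \<xi>)\<^sup>2"
          by (intro order_trans[OF comparison] mult_left_mono) (use A in auto)
        then show "ennreal (Re (q' x \<xi>)) \<le> ennreal A * ennreal ((norm \<xi>)\<^sup>2)"
          using A by (simp add: ennreal_leI flip: ennreal_mult)
      qed
      then show ?thesis
        using A nn_integral_inverse_square_ball
        by (intro exI[of _ A] exI[of _ "\<lambda>\<xi>. ennreal ((norm \<xi>)\<^sup>2)"] conjI) simp_all
    qed
    then obtain B s where B: "0 < B"
      and s: "\<And>r. 0 < r \<Longrightarrow> (\<integral>\<^sup>+ \<xi>\<in>ball 0 r. 1 / s \<xi> \<partial>lborel) = \<infinity>"
      and le: "\<And>\<xi>. norm \<xi> < 1 \<Longrightarrow> sup_symbol q' \<xi> \<le> ennreal B * s \<xi>" by blast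
    fix r :: real assume "0 < r"
    have "(\<integral>\<^sup>+ \<xi>\<in>ball 0 (min r 1). 1 / s \<xi> \<partial>lborel)
        \<le> ennreal B * (\<integral>\<^sup>+ \<xi>\<in>ball 0 r. 1 / sup_symbol q' \<xi> \<partial>lborel)"
      by (rule nn_integral_reciprocal_ball_le[OF B]) (auto intro: le)
    then show "(\<integral>\<^sup>+ \<xi>\<in>ball 0 r. 1 / sup_symbol q' \<xi> \<partial>lborel) = \<infinity>"
      using s[of "min r 1"] \<open>0 < r\<close> by (simp add: top_unique ennreal_mult_eq_top_iff)
  next
    assume lim: "Liminf (at 0) (\<lambda>\<xi>. INF x. \<integral>\<^sup>+ y. ennreal ((1 - cos (\<xi> \<bullet> y)) / (norm \<xi>)\<^sup>2) \<partial>\<nu> x) = \<infinity>"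
      and "\<exists>r>0. (\<integral>\<^sup>+ \<xi>\<in>ball 0 r. 1 / inf_symbol q' \<xi> \<partial>lborel) < \<infinity>"
    then obtain r where r: "0 < r" "(\<integral>\<^sup>+ \<xi>\<in>ball 0 r. 1 / inf_symbol q' \<xi> \<partial>lborel) < \<infinity>" by blast
    have "\<forall>\<^sub>F \<xi> in at 0. 1 < (INF x. \<integral>\<^sup>+ y. ennreal ((1 - cos (\<xi> \<bullet> y)) / (norm \<xi>)\<^sup>2) \<partial>\<nu> x)"
      by (rule less_LiminfD) (simp add: lim)
    then obtain \<delta> where \<delta>: "0 < \<delta>" and one_less: "\<And>\<xi>. \<xi> \<noteq> 0 \<Longrightarrow> norm \<xi> < \<delta> \<Longrightarrow>
        1 < (INF x. \<integral>\<^sup>+ y. ennreal ((1 - cos (\<xi> \<bullet> y)) / (norm \<xi>)\<^sup>2) \<partial>\<nu> x)"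
      by (auto simp: eventually_at)
    \<comment> \<open>Near the origin, the divergent lower limit lets \<open>q\<close> itself absorb the quadratic error term.\<close>
    have sq: "(norm \<xi>)\<^sup>2 \<le> Re (q x \<xi>)" if "norm \<xi> < \<delta>" for x \<xi>
    proof (cases "\<xi> = 0")
      case True
      then show ?thesis using nonneg[of x 0] by simp
    next
      case False
      note [measurable_cong] = levy_exponent.sets_\<nu>[OF levy]
      have "1 \<le> (\<integral>\<^sup>+ y. ennreal ((1 - cos (\<xi> \<bullet> y)) / (norm \<xi>)\<^sup>2) \<partial>\<nu> x)"
        using one_less[OF False that] by (meson INF_lower UNIV_I less_imp_le order_less_le_trans)
      then have "ennreal ((norm \<xi>)\<^sup>2) * 1
          \<le> ennreal ((norm \<xi>)\<^sup>2) * (\<integral>\<^sup>+ y. ennreal ((1 - cos (\<xi> \<bullet> y)) / (norm \<xi>)\<^sup>2) \<partial>\<nu> x)"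
        by (rule mult_left_mono) simp
      also have "\<dots> = (\<integral>\<^sup>+ y. ennreal ((norm \<xi>)\<^sup>2) * ennreal ((1 - cos (\<xi> \<bullet> y)) / (norm \<xi>)\<^sup>2) \<partial>\<nu> x)"
        by (rule nn_integral_cmult[symmetric]) measurable
      also have "\<dots> = (\<integral>\<^sup>+ y. ennreal (1 - cos (\<xi> \<bullet> y)) \<partial>\<nu> x)"
        using False by (subst ennreal_mult[symmetric]) auto
      also have "\<dots> \<le> ennreal (Re (q x \<xi>))"
        by (simp add: levy_exponent.ennreal_Re_exponent[OF levy] add_increasing)
      finally show ?thesis using nonneg by (simp add: ennreal_le_iff)
    qed
    have "inf_symbol q' \<xi> \<le> ennreal (2 * A) * inf_symbol q \<xi>" if "norm \<xi> < min r \<delta>" for \<xi>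
    proof -
      have inv: "ennreal (1 / (2 * A)) * ennreal (2 * A) = 1"
        using A by (subst ennreal_mult[symmetric]) auto
      have "ennreal (1 / (2 * A)) * inf_symbol q' \<xi> \<le> inf_symbol q \<xi>"
        unfolding inf_symbol_def[of q]
      proof (rule INF_greatest)
        fix x
        have "Re (q' x \<xi>) \<le> A * (Re (q x \<xi>) + Re (q x \<xi>))"
          by (rule order_trans[OF comparison]) (use A sq[of \<xi> x] that in auto)
        then have "ennreal (Re (q' x \<xi>)) \<le> ennreal (2 * A * Re (q x \<xi>))"
          by (intro ennreal_leI) simp
        also have "\<dots> = ennreal (2 * A) * ennreal (Re (q x \<xi>))"
          using A nonneg by (intro ennreal_mult) auto
        finally have "inf_symbol q' \<xi> \<le> ennreal (2 * A) * ennreal (Re (q x \<xi>))"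
          unfolding inf_symbol_def by (rule INF_lower2[OF UNIV_I])
        then have "ennreal (1 / (2 * A)) * inf_symbol q' \<xi>
            \<le> ennreal (1 / (2 * A)) * (ennreal (2 * A) * ennreal (Re (q x \<xi>)))"
          by (rule mult_left_mono) simp
        also have "\<dots> = ennreal (Re (q x \<xi>))" by (simp only: mult.assoc[symmetric] inv mult_1)
        finally show "ennreal (1 / (2 * A)) * inf_symbol q' \<xi> \<le> ennreal (Re (q x \<xi>))" .
      qed
      then have "ennreal (2 * A) * (ennreal (1 / (2 * A)) * inf_symbol q' \<xi>)
          \<le> ennreal (2 * A) * inf_symbol q \<xi>"
        by (rule mult_left_mono) simp
      moreover have "ennreal (2 * A) * (ennreal (1 / (2 * A)) * inf_symbol q' \<xi>) = inf_symbol q' \<xi>"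
        using inv by (metis mult.assoc mult.commute mult_1)
      ultimately show ?thesis by simp
    qed
    then have "(\<integral>\<^sup>+ \<xi>\<in>ball 0 (min r \<delta>). 1 / inf_symbol q \<xi> \<partial>lborel)
        \<le> ennreal (2 * A) * (\<integral>\<^sup>+ \<xi>\<in>ball 0 r. 1 / inf_symbol q' \<xi> \<partial>lborel)"
      using A by (intro nn_integral_reciprocal_ball_le) auto
    also have "\<dots> < \<infinity>" using r(2) by (simp add: ennreal_mult_less_top)
    finally show "\<exists>r>0. (\<integral>\<^sup>+ \<xi>\<in>ball 0 r. 1 / inf_symbol q \<xi> \<partial>lborel) < \<infinity>"
      using r(1) \<delta> by (intro exI[of _ "min r \<delta>"]) simp
  }
qed

end
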